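(* For $n=0,1,2,\ldots$ let $e_n(z)=z^n$, $z\in\mathbb{D}$, and let $\Lambda=(e_n)_{n=0}^\infty$ be the sequence of monomials. Then: (i) for every $\gamma\in[0,\infty[$, $\Lambda$ is a Schauder basis of the Fréchet space $A^{-\gamma}_+$; (ii) for every $\gamma\in\,]0,\infty[$, $\Lambda$ is a Schauder basis of the (LB)-space $A^{-\gamma}_-$.
   Context: Let $\mathbb{D}=\{z\in\mathbb{C}:|z|<1\}$. For $f:\mathbb{D}\to\mathbb{C}$ and $0\le r<1$ put $M_\infty(f,r)=\sup_{|z|=r}|f(z)|$. For $\mu>0$ let $\|f\|_\mu=\sup_{0\le r<1}M_\infty(f,r)(1-r)^\mu$, and let $A^{-\mu}$ be the Banach space of all analytic $f:\mathbb{D}\to\mathbb{C}$ with $\|f\|_\mu<\infty$, normed by $\|\cdot\|_\mu$. If $\mu_1>\mu_2$ then $\|\cdot\|_{\mu_1}\le\|\cdot\|_{\mu_2}$ and $A^{-\mu_2}\subset A^{-\mu_1}$. For $\gamma\in[0,\infty[$, $A^{-\gamma}_+=\bigcap_{\mu>\gamma}A^{-\mu}$, endowed with the locally convex topology generated by the norms $\|\cdot\|_\mu$, $\mu>\gamma$; it is a Fréchet space. For $\gamma>0$, $A^{-\gamma}_-=\bigcup_{0<\mu<\gamma}A^{-\mu}$, endowed with the finest locally convex topology such that all inclusions $A^{-\mu}\subset A^{-\gamma}_-$, $0<\mu<\gamma$, are continuous; it is an (LB)-space (a Hausdorff countable inductive limit of Banach spaces). A sequence $(x_n)_n$ in a (complex)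 locally convex space $E$ is a Schauder basis of $E$ if every $x\in E$ can be written in a unique way as $x=\sum_{n}u_n(x)x_n$ (convergence in $E$), where the coefficient maps $u_n:E\to\mathbb{C}$ are continuous linear forms. *)

theory Defs
  imports "HOL-Complex_Analysis.Complex_Analysis" "HOL-Library.Function_Algebras"
begin

section \<open>Locally convex topologies on complex vector spaces\<close>

text \<open>
  A complex vector space is given by a scalar multiplication on an additive group together with
  a carrier \<open>E\<close>; its topology is an abstract topology with \<open>topspace T = E\<close>.
\<close>

definition convex_wrt :: "(complex \<Rightarrow> 'v::ab_group_add \<Rightarrow> 'v) \<Rightarrow> 'v set \<Rightarrow> bool" where
  "convex_wrt smul W \<longleftrightarrow>
     (\<forall>x\<in>W. \<forall>y\<in>W. \<forall>t::real. 0 \<le> t \<and> t \<le> 1 \<longrightarrow>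
        smul (of_real (1 - t)) x + smul (of_real t) y \<in> W)"

definition locally_convex_topology ::
    "(complex \<Rightarrow> 'v::ab_group_add \<Rightarrow> 'v) \<Rightarrow> 'v set \<Rightarrow> 'v topology \<Rightarrow> bool" where
  "locally_convex_topology smul E T \<longleftrightarrow>
     vector_space smul \<and> module.subspace smul E \<and> topspace T = E \<and>
     continuous_map (prod_topology T T) T (\<lambda>(x, y). x + y) \<and>
     continuous_map (prod_topology euclidean T) T (\<lambda>(c, x). smul c x) \<and>
     (\<forall>U. openin T U \<and> 0 \<in> U \<longrightarrow>
        (\<exists>W. openin T W \<and> 0 \<in> W \<and> W \<subseteq> U \<and> convex_wrt smul W))"

text \<open>Locally convex spaces are taken to be Hausdorff, so that sums of series are unique.\<close>

definition locally_convex_space ::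
    "(complex \<Rightarrow> 'v::ab_group_add \<Rightarrow> 'v) \<Rightarrow> 'v set \<Rightarrow> 'v topology \<Rightarrow> bool" where
  "locally_convex_space smul E T \<longleftrightarrow> locally_convex_topology smul E T \<and> Hausdorff_space T"

definition seminorm_topology :: "'v::ab_group_add set \<Rightarrow> ('v \<Rightarrow> real) set \<Rightarrow> 'v topology" where
  "seminorm_topology E P =
     topology_generated_by {{y \<in> E. p (y - x) < \<epsilon>} | x p \<epsilon>. x \<in> E \<and> p \<in> P \<and> 0 < \<epsilon>}"

text \<open>
  The finest locally convex topology on \<open>E\<close> for which the inclusions of all spaces in \<open>\<S>\<close>
  are continuous, constructed as the supremum of all locally convex topologies with this property.
  Lemma \<open>inductive_topology_finest\<close> shows that this supremum is itself such a topology, and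
  \<open>openin_inductive_topology\<close> that it is the finest one.
\<close>

definition inductive_topology ::
    "(complex \<Rightarrow> 'v::ab_group_add \<Rightarrow> 'v) \<Rightarrow> 'v set \<Rightarrow> 'v topology set \<Rightarrow> 'v topology" where
  "inductive_topology smul E \<S> =
     topology_generated_by
       {U. \<exists>T. locally_convex_topology smul E T \<and>
               (\<forall>S\<in>\<S>. continuous_map S T (\<lambda>x. x)) \<and> openin T U}"

lemma openin_inductive_topology:
  assumes "locally_convex_topology smul E T" "\<And>S. S \<in> \<S> \<Longrightarrow> continuous_map S T (\<lambda>x. x)" "openin T U"
  shows "openin (inductive_topology smul E \<S>) U"
  unfolding inductive_topology_def by (rule topology_generated_by_Basis) (use assms in blast)

lemma continuous_map_into_indiscrete:
  assumes "h ` topspace X \<subseteq> E"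
  shows "continuous_map X (topology_generated_by {E}) h"
proof (rule continuous_on_generated_topo)
  fix U assume "U \<in> {E}"
  then have "h -` U \<inter> topspace X = topspace X" using assms by auto
  then show "openin X (h -` U \<inter> topspace X)" by simp
qed (use assms in simp)

lemma locally_convex_topology_indiscrete:
  assumes "vector_space smul" "module.subspace smul E"
  shows "locally_convex_topology smul E (topology_generated_by {E})"
proof -
  interpret vector_space smul by fact
  let ?T = "topology_generated_by {E}"
  have sub: "subspace E" by fact
  have op: "U = {} \<or> U = E" if "openin ?T U" for U
  proof -
    have "generate_topology_on {E} U" using that by (simp add: openin_topology_generated_by_iff)
    then show ?thesis by induction auto
  qed
  have opE: "openin ?T E" by (rule topology_generated_by_Basis) simp
  have "continuous_map (prod_topology ?T ?T) ?T (\<lambda>(x, y). x + y)"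
    by (rule continuous_map_into_indiscrete) (auto simp: topology_generated_by_topspace intro: subspace_add[OF sub])
  moreover have "continuous_map (prod_topology euclidean ?T) ?T (\<lambda>(c, x). smul c x)"
    by (rule continuous_map_into_indiscrete) (auto simp: topology_generated_by_topspace intro: subspace_scale[OF sub])
  moreover have "convex_wrt smul E"
    by (auto simp: convex_wrt_def intro!: subspace_add[OF sub] subspace_scale[OF sub])
  ultimately show ?thesis
    unfolding locally_convex_topology_def
    using assms op opE by (metis Union_insert Union_empty sup_bot_right empty_iff order_refl topology_generated_by_topspace)
qed

lemma inductive_topology_finest:
  assumes "vector_space smul" "module.subspace smul E" "\<And>S. S \<in> \<S> \<Longrightarrow> topspace S \<subseteq> E"
  shows "locally_convex_topology smul E (inductive_topology smul E \<S>)"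
    and "S \<in> \<S> \<Longrightarrow> continuous_map S (inductive_topology smul E \<S>) (\<lambda>x. x)"
proof -
  define A where "A = {T. locally_convex_topology smul E T \<and> (\<forall>S\<in>\<S>. continuous_map S T (\<lambda>x. x))}"
  define B where "B = {U. \<exists>T\<in>A. openin T U}"
  let ?L = "topology_generated_by B"
  have L: "inductive_topology smul E \<S> = ?L"
    by (simp add: inductive_topology_def A_def B_def conj_assoc)
  interpret vector_space smul by fact
  have sub: "subspace E" by fact
  have tA: "topspace T = E" if "T \<in> A" for T
    using that by (simp add: A_def locally_convex_topology_def)
  have "topology_generated_by {E} \<in> A"
    using locally_convex_topology_indiscrete[OF assms(1,2)] assms(3)
    by (simp add: A_def continuous_map_into_indiscrete)
  then have "E \<in> B"
    unfolding B_def using topology_generated_by_Basis by blast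
  moreover have "U \<subseteq> E" if "U \<in> B" for U
    using that tA openin_subset unfolding B_def by blast
  ultimately have UB: "\<Union>B = E" by blast
  then have tL: "topspace ?L = E" by (simp add: topology_generated_by_topspace)
  have LT: "continuous_map ?L T (\<lambda>x. x)" if "T \<in> A" for T
  proof -
    have "openin ?L U" if "openin T U" for U
      by (rule topology_generated_by_Basis) (use that \<open>T \<in> A\<close> in \<open>auto simp: B_def\<close>)
    then have "continuous_map ?L T id"
      using topology_finer_continuous_id[of T ?L] tL tA[OF that] by auto
    then show ?thesis by (simp add: id_def)
  qed
  have into: "continuous_map X ?L h"
    if h: "\<And>T. T \<in> A \<Longrightarrow> continuous_map X T h" for X :: "'x topology" and h
  proof (rule continuous_on_generated_topo)
    show "openin X (h -` U \<inter> topspace X)" if U: "U \<in> B" for U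
    proof -
      obtain T where "T \<in> A" "openin T U" using U by (auto simp: B_def)
      then have "openin X {x \<in> topspace X. h x \<in> U}"
        using h openin_continuous_map_preimage by blast
      moreover have "{x \<in> topspace X. h x \<in> U} = h -` U \<inter> topspace X" by auto
      ultimately show ?thesis by simp
    qed
    have "h ` topspace X \<subseteq> E"
      using h[OF \<open>topology_generated_by {E} \<in> A\<close>] tA[OF \<open>topology_generated_by {E} \<in> A\<close>]
        continuous_map_image_subset_topspace by metis
    then show "h ` topspace X \<subseteq> \<Union>B" using UB by simp
  qed
  show "continuous_map S (inductive_topology smul E \<S>) (\<lambda>x. x)" if "S \<in> \<S>"
    unfolding L by (rule into) (use that in \<open>simp add: A_def\<close>)
  have add: "continuous_map (prod_topology ?L ?L) ?L (\<lambda>(x, y). x + y)"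
  proof (rule into)
    fix T assume T: "T \<in> A"
    have "continuous_map (prod_topology ?L ?L) (prod_topology T T) (\<lambda>p. (fst p, snd p))"
      by (intro continuous_map_pairedI continuous_map_compose[OF continuous_map_fst LT[OF T], unfolded o_def]
           continuous_map_compose[OF continuous_map_snd LT[OF T], unfolded o_def])
    moreover have "continuous_map (prod_topology T T) T (\<lambda>(x, y). x + y)"
      using T by (simp add: A_def locally_convex_topology_def)
    ultimately show "continuous_map (prod_topology ?L ?L) T (\<lambda>(x, y). x + y)"
      using continuous_map_compose[of _ _ "\<lambda>p. (fst p, snd p)" T "\<lambda>(x, y). x + y"]
      by (simp add: o_def)
  qed
  have mul: "continuous_map (prod_topology euclidean ?L) ?L (\<lambda>(c, x). smul c x)"
  proof (rule into)
    fix T assume T: "T \<in> A"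
    have "continuous_map (prod_topology euclidean ?L) (prod_topology euclidean T) (\<lambda>p. (fst p, snd p))"
      by (intro continuous_map_pairedI continuous_map_fst
           continuous_map_compose[OF continuous_map_snd LT[OF T], unfolded o_def])
    moreover have "continuous_map (prod_topology euclidean T) T (\<lambda>(c, x). smul c x)"
      using T by (simp add: A_def locally_convex_topology_def)
    ultimately show "continuous_map (prod_topology euclidean ?L) T (\<lambda>(c, x). smul c x)"
      using continuous_map_compose[of _ _ "\<lambda>p. (fst p, snd p)" T "\<lambda>(c, x). smul c x"]
      by (simp add: o_def)
  qed
  have base: "\<exists>W. openin ?L W \<and> 0 \<in> W \<and> W \<subseteq> U \<and> convex_wrt smul W"
    if "generate_topology_on B U" "0 \<in> U" for U
    using that
  proof induction
    case (Int a b)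
    then obtain V W where "openin ?L V" "0 \<in> V" "V \<subseteq> a" "convex_wrt smul V"
      "openin ?L W" "0 \<in> W" "W \<subseteq> b" "convex_wrt smul W" by auto
    then show ?case
      by (intro exI[of _ "V \<inter> W"]) (auto simp: convex_wrt_def openin_Int)
  next
    case (UN K)
    then obtain k where "k \<in> K" "0 \<in> k" by auto
    then show ?case using UN.IH by (meson Union_upper subset_trans)
  next
    case (Basis U)
    then obtain T where T: "T \<in> A" "openin T U" by (auto simp: B_def)
    then obtain W where "openin T W" "0 \<in> W" "W \<subseteq> U" "convex_wrt smul W"
      using Basis unfolding A_def locally_convex_topology_def by blast
    moreover have "openin ?L W"
      by (rule topology_generated_by_Basis) (use T \<open>openin T W\<close> in \<open>auto simp: B_def\<close>)
    ultimately show ?case by blast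
  qed auto
  show "locally_convex_topology smul E (inductive_topology smul E \<S>)"
    unfolding L locally_convex_topology_def
    using assms(1,2) tL add mul base by (auto simp: openin_topology_generated_by_iff)
qed

definition linear_form_on ::
    "(complex \<Rightarrow> 'v::ab_group_add \<Rightarrow> 'v) \<Rightarrow> 'v set \<Rightarrow> ('v \<Rightarrow> complex) \<Rightarrow> bool" where
  "linear_form_on smul E u \<longleftrightarrow>
     (\<forall>x\<in>E. \<forall>y\<in>E. u (x + y) = u x + u y) \<and> (\<forall>c. \<forall>x\<in>E. u (smul c x) = c * u x)"

definition schauder_basis ::
    "(complex \<Rightarrow> 'v::ab_group_add \<Rightarrow> 'v) \<Rightarrow> 'v set \<Rightarrow> 'v topology \<Rightarrow> (nat \<Rightarrow> 'v) \<Rightarrow> bool" where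
  "schauder_basis smul E T b \<longleftrightarrow>
     locally_convex_space smul E T \<and> (\<forall>n. b n \<in> E) \<and>
     (\<exists>u :: nat \<Rightarrow> 'v \<Rightarrow> complex.
        (\<forall>n. linear_form_on smul E (u n) \<and> continuous_map T euclidean (u n)) \<and>
        (\<forall>x\<in>E.
           limitin T (\<lambda>N. \<Sum>n<N. smul (u n x) (b n)) x sequentially \<and>
           (\<forall>c. limitin T (\<lambda>N. \<Sum>n<N. smul (c n) (b n)) x sequentially
                  \<longrightarrow> (\<forall>n. c n = u n x))))"

section \<open>Growth spaces of analytic functions on the unit disc\<close>

definition fun_scale :: "complex \<Rightarrow> (complex \<Rightarrow> complex) \<Rightarrow> complex \<Rightarrow> complex" where
  "fun_scale c f = (\<lambda>z. c * f z)"

definition M_infty :: "(complex \<Rightarrow> complex) \<Rightarrow> real \<Rightarrow> ennreal" where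
  "M_infty f r = (SUP z\<in>sphere 0 r. ennreal (cmod (f z)))"

definition growth_norm :: "real \<Rightarrow> (complex \<Rightarrow> complex) \<Rightarrow> ennreal" where
  "growth_norm \<mu> f = (SUP r\<in>{0..<1}. M_infty f r * ennreal ((1 - r) powr \<mu>))"

text \<open>
  A function on the unit disc is represented by its extension by zero to the complex plane, so
  that equality of functions on the disc is equality in the type.
\<close>

definition growth_space :: "real \<Rightarrow> (complex \<Rightarrow> complex) set" where
  "growth_space \<mu> =
     {f. f analytic_on ball 0 1 \<and> (\<forall>z. z \<notin> ball 0 1 \<longrightarrow> f z = 0) \<and> growth_norm \<mu> f < \<infinity>}"

definition growth_norm_real :: "real \<Rightarrow> (complex \<Rightarrow> complex) \<Rightarrow> real" where
  "growth_norm_real \<mu> f = enn2real (growth_norm \<mu> f)"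

definition growth_topology :: "real \<Rightarrow> (complex \<Rightarrow> complex) topology" where
  "growth_topology \<mu> = seminorm_topology (growth_space \<mu>) {growth_norm_real \<mu>}"

definition growth_space_plus :: "real \<Rightarrow> (complex \<Rightarrow> complex) set" where
  "growth_space_plus \<gamma> = (\<Inter>\<mu>\<in>{\<gamma><..}. growth_space \<mu>)"

definition growth_topology_plus :: "real \<Rightarrow> (complex \<Rightarrow> complex) topology" where
  "growth_topology_plus \<gamma> =
     seminorm_topology (growth_space_plus \<gamma>) (growth_norm_real ` {\<gamma><..})"

definition growth_space_minus :: "real \<Rightarrow> (complex \<Rightarrow> complex) set" where
  "growth_space_minus \<gamma> = (\<Union>\<mu>\<in>{0<..<\<gamma>}. growth_space \<mu>)"

definition growth_topology_minus :: "real \<Rightarrow> (complex \<Rightarrow> complex) topology" where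
  "growth_topology_minus \<gamma> =
     inductive_topology fun_scale (growth_space_minus \<gamma>) (growth_topology ` {0<..<\<gamma>})"

definition monomial :: "nat \<Rightarrow> complex \<Rightarrow> complex" where
  "monomial n = (\<lambda>z. if z \<in> ball 0 1 then z ^ n else 0)"

end

theory Submission imports Defs begin

text \<open>
  The coefficient forms are the Taylor coefficients at \<open>0\<close>, which Cauchy's inequality bounds by each
  of the norms. For the expansion it suffices that the Taylor sums of \<open>f \<in> A\<^sup>-\<^sup>\<mu>\<close> converge to \<open>f\<close> in
  the norm of index \<open>\<nu>\<close> whenever \<open>\<mu> < \<nu>\<close>. Cauchy's formula writes the \<open>N\<close>-th remainder at \<open>z\<close> as the
  integral of \<open>f w (z/w)\<^sup>N / (w - z)\<close> over a circle of radius \<open>(1 + |z|)/2\<close>; since the integral of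
  \<open>1/|w - z|\<close> is only logarithmic in \<open>1/(1 - |z|)\<close>, the remainder is, up to this logarithm, of the
  same growth as \<open>f\<close>, and any \<open>\<nu> > \<mu>\<close> absorbs it. In the inductive limit, Hausdorffness and
  continuity of the coefficients come from comparison with the coarser topology of the single norm
  of index \<open>\<gamma>\<close>.
\<close>

section \<open>Topologies given by seminorms\<close>

definition seminorm_on ::
    "(complex \<Rightarrow> 'v::ab_group_add \<Rightarrow> 'v) \<Rightarrow> 'v set \<Rightarrow> ('v \<Rightarrow> real) \<Rightarrow> bool" where
  "seminorm_on smul E p \<longleftrightarrow>
     (\<forall>x\<in>E. \<forall>y\<in>E. p (x + y) \<le> p x + p y) \<and> (\<forall>c. \<forall>x\<in>E. p (smul c x) = cmod c * p x)"

text \<open>With \<open>P\<close> nonempty the subbasic balls cover \<open>E\<close>; the empty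
  family would generate a topology with empty carrier.\<close>

locale seminormed_space = vector_space smul
  for smul :: "complex \<Rightarrow> 'v::ab_group_add \<Rightarrow> 'v" +
  fixes E :: "'v set" and P :: "('v \<Rightarrow> real) set"
  assumes subspace_E: "subspace E"
    and P_nonempty: "P \<noteq> {}"
    and seminorm: "p \<in> P \<Longrightarrow> seminorm_on smul E p"
begin

abbreviation "T \<equiv> seminorm_topology E P"

lemma mem_E [simp]:
  "0 \<in> E" "x \<in> E \<Longrightarrow> y \<in> E \<Longrightarrow> x + y \<in> E" "x \<in> E \<Longrightarrow> y \<in> E \<Longrightarrow> x - y \<in> E" "x \<in> E \<Longrightarrow> smul c x \<in> E"
  using subspace_E by (auto intro: subspace_0 subspace_add subspace_diff subspace_scale)

lemma seminorm_add: "p \<in> P \<Longrightarrow> x \<in> E \<Longrightarrow> y \<in> E \<Longrightarrow> p (x + y) \<le> p x + p y"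
  using seminorm by (auto simp: seminorm_on_def)

lemma seminorm_scale: "p \<in> P \<Longrightarrow> x \<in> E \<Longrightarrow> p (smul c x) = cmod c * p x"
  using seminorm by (auto simp: seminorm_on_def)

lemma seminorm_0: "p \<in> P \<Longrightarrow> p 0 = 0"
  using seminorm_scale[of p 0 0] by simp

lemma seminorm_minus_commute: "p \<in> P \<Longrightarrow> x \<in> E \<Longrightarrow> y \<in> E \<Longrightarrow> p (x - y) = p (y - x)"
  using seminorm_scale[of p "y - x" "-1"] by simp

text \<open>Follows from 0 = p 0 \<le> p x + p (-x) = 2 p x.\<close>

lemma seminorm_nonneg: "p \<in> P \<Longrightarrow> x \<in> E \<Longrightarrow> 0 \<le> p x"
  using seminorm_add[of p x "0 - x"] seminorm_minus_commute[of p 0 x] seminorm_0[of p] mem_E(3)[OF mem_E(1), of x]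
  by simp

lemma seminorm_triangle:
  "p \<in> P \<Longrightarrow> x \<in> E \<Longrightarrow> y \<in> E \<Longrightarrow> z \<in> E \<Longrightarrow> p (x - z) \<le> p (x - y) + p (y - z)"
  using seminorm_add[of p "x - y" "y - z"] by simp

lemma topspace_seminorm_topology [simp]: "topspace T = E"
  unfolding seminorm_topology_def topology_generated_by_topspace
proof (intro subset_antisym subsetI)
  obtain p where p: "p \<in> P" using P_nonempty by auto
  fix x assume x: "x \<in> E"
  have "x \<in> {y \<in> E. p (y - x) < 1}" using x p seminorm_0[OF p] by simp
  moreover have "{y \<in> E. p (y - x) < 1} \<in> {{y \<in> E. p (y - x) < \<epsilon>} | x p \<epsilon>. x \<in> E \<and> p \<in> P \<and> 0 < \<epsilon>}"
    unfolding mem_Collect_eq using x p zero_less_one by (intro exI conjI) (rule refl)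
  ultimately show "x \<in> \<Union> {{y \<in> E. p (y - x) < \<epsilon>} | x p \<epsilon>. x \<in> E \<and> p \<in> P \<and> 0 < \<epsilon>}"
    by (rule UnionI[rotated])
qed auto

text \<open>The subbasis has only balls of positive radius. For any other radius the ball is empty,
  because seminorms are nonnegative, so later uses carry no positivity condition.\<close>

lemma openin_seminorm_ball:
  assumes "x \<in> E" "p \<in> P"
  shows "openin T {y \<in> E. p (y - x) < \<epsilon>}"
proof (cases "0 < \<epsilon>")
  case True
  then have "\<exists>x' p' \<epsilon>'. {y \<in> E. p (y - x) < \<epsilon>} = {y \<in> E. p' (y - x') < \<epsilon>'} \<and> x' \<in> E \<and> p' \<in> P \<and> 0 < \<epsilon>'"
    using assms by (intro exI conjI) (rule refl)
  then show ?thesis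
    unfolding seminorm_topology_def by (intro topology_generated_by_Basis CollectI)
next
  case False
  have "0 \<le> p (y - x)" if "y \<in> E" for y
    using assms that by (intro seminorm_nonneg mem_E)
  then have "{y \<in> E. p (y - x) < \<epsilon>} = {}" using False by force
  then show ?thesis by (metis openin_empty)
qed

text \<open>Subbasic balls may be centred anywhere, whereas estimates for sums and products are
  natural around the image point \<open>h a\<close>. The triangle inequality mediates: the ball of
  radius \<epsilon> - p (h a - x) around \<open>h a\<close> lies in the given ball around
  \<open>x\<close>.\<close>

lemma continuous_map_into_seminorm_topology:
  assumes "h ` topspace X \<subseteq> E"
    and "\<And>a p \<epsilon>. a \<in> topspace X \<Longrightarrow> p \<in> P \<Longrightarrow> 0 < \<epsilon> \<Longrightarrow>
           \<exists>V. openin X V \<and> a \<in> V \<and> (\<forall>b\<in>V. p (h b - h a) < \<epsilon>)"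
  shows "continuous_map X T h"
  unfolding seminorm_topology_def
proof (rule continuous_on_generated_topo)
  show "h ` topspace X \<subseteq> \<Union> {{y \<in> E. p (y - x) < \<epsilon>} | x p \<epsilon>. x \<in> E \<and> p \<in> P \<and> 0 < \<epsilon>}"
    using assms(1) topspace_seminorm_topology
    unfolding seminorm_topology_def topology_generated_by_topspace by (elim ssubst)
next
  fix U assume "U \<in> {{y \<in> E. p (y - x) < \<epsilon>} | x p \<epsilon>. x \<in> E \<and> p \<in> P \<and> 0 < \<epsilon>}"
  then obtain x p \<epsilon> where U: "U = {y \<in> E. p (y - x) < \<epsilon>}" "x \<in> E" "p \<in> P" by auto
  show "openin X (h -` U \<inter> topspace X)"
  proof (subst openin_subopen, rule ballI)
    fix a assume a: "a \<in> h -` U \<inter> topspace X"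
    then have pa: "0 < \<epsilon> - p (h a - x)" using U by simp
    obtain V where V: "openin X V" "a \<in> V" "\<forall>b\<in>V. p (h b - h a) < \<epsilon> - p (h a - x)"
      using assms(2)[OF _ U(3) pa] a by auto
    have "V \<subseteq> h -` U \<inter> topspace X"
    proof
      fix b assume b: "b \<in> V"
      then have b': "b \<in> topspace X" using V(1) openin_subset by blast
      have hE: "h b \<in> E" "h a \<in> E" using assms(1) a b' by auto
      then have "p (h b - x) < \<epsilon>"
        using seminorm_triangle[OF U(3) hE U(2)] V(3) b by auto
      then show "b \<in> h -` U \<inter> topspace X" using U b' hE by simp
    qed
    then show "\<exists>T. openin X T \<and> a \<in> T \<and> T \<subseteq> h -` U \<inter> topspace X" using V by blast
  qed
qed

lemma continuous_map_add: "continuous_map (prod_topology T T) T (\<lambda>(x, y). x + y)"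
proof (rule continuous_map_into_seminorm_topology)
  show "(\<lambda>(x, y). x + y) ` topspace (prod_topology T T) \<subseteq> E"
    unfolding topspace_prod_topology topspace_seminorm_topology by (simp add: image_subset_iff)
next
  fix a p and \<epsilon> :: real
  assume a: "a \<in> topspace (prod_topology T T)" "p \<in> P" "0 < \<epsilon>"
  obtain x y where xy: "a = (x, y)" "x \<in> E" "y \<in> E"
    using a(1) unfolding topspace_prod_topology topspace_seminorm_topology by blast
  let ?V = "{z \<in> E. p (z - x) < \<epsilon> / 2} \<times> {z \<in> E. p (z - y) < \<epsilon> / 2}"
  have o: "openin (prod_topology T T) ?V"
    using a(2) xy by (intro openin_prod_Times_iff[THEN iffD2] disjI2 conjI openin_seminorm_ball)
  have m: "a \<in> ?V" using a xy seminorm_0[OF a(2)] by simp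
  have bd: "p ((case b of (x, y) \<Rightarrow> x + y) - (case a of (x, y) \<Rightarrow> x + y)) < \<epsilon>" if "b \<in> ?V" for b
  proof -
    obtain x' y' where b: "b = (x', y')" by (cases b)
    have "p ((x' - x) + (y' - y)) \<le> p (x' - x) + p (y' - y)"
      using that xy a b by (intro seminorm_add) auto
    also have "\<dots> < \<epsilon>" using that b by simp
    finally show ?thesis unfolding b xy(1) prod.case add_diff_add .
  qed
  show "\<exists>V. openin (prod_topology T T) V \<and> a \<in> V \<and>
      (\<forall>b\<in>V. p ((case b of (x, y) \<Rightarrow> x + y) - (case a of (x, y) \<Rightarrow> x + y)) < \<epsilon>)"
    using o m bd by (intro exI[of _ ?V] conjI ballI)
qed

lemma continuous_map_scale: "continuous_map (prod_topology euclidean T) T (\<lambda>(c, x). smul c x)"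
proof (rule continuous_map_into_seminorm_topology)
  show "(\<lambda>(c, x). smul c x) ` topspace (prod_topology euclidean T) \<subseteq> E"
    unfolding topspace_prod_topology topspace_seminorm_topology by (simp add: image_subset_iff)
next
  fix a :: "complex \<times> 'v" and p and \<epsilon> :: real
  assume a: "a \<in> topspace (prod_topology euclidean T)" "p \<in> P" "0 < \<epsilon>"
  obtain c x where cx: "a = (c, x)" "x \<in> E"
    using a(1) unfolding topspace_prod_topology topspace_seminorm_topology by blast
  have px: "0 \<le> p x" using seminorm_nonneg[OF a(2) cx(2)] .
  \<comment> \<open>The difference is split as c' (x' - x) + (c' - c) x. The radius \<open>d\<close>
    makes the second term at most \<epsilon>/2 and forces |c'| \<le> |c| + 1; given this,
    \<open>e\<close> makes the first term less than \<epsilon>/2.\<close>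
  define d where "d = min 1 (\<epsilon> / (2 * (p x + 1)))"
  define e where "e = \<epsilon> / (2 * (cmod c + 1))"
  have d: "0 < d" "d \<le> 1" "d * p x \<le> \<epsilon> / 2"
  proof -
    show "0 < d" "d \<le> 1" using a px by (auto simp: d_def)
    have "d * p x \<le> (\<epsilon> / (2 * (p x + 1))) * (p x + 1)"
      using px a by (intro mult_mono) (auto simp: d_def)
    also have "\<dots> = \<epsilon> / 2"
      using nonzero_mult_div_cancel_right[of "p x + 1" "\<epsilon> / 2"] px by (simp add: mult.commute)
    finally show "d * p x \<le> \<epsilon> / 2" .
  qed
  have e: "0 < e" "(cmod c + 1) * e = \<epsilon> / 2"
  proof -
    have "0 < cmod c + 1" using norm_ge_zero[of c] by linarith
    then show "0 < e" "(cmod c + 1) * e = \<epsilon> / 2" using a by (auto simp: e_def field_simps)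
  qed
  let ?V = "ball c d \<times> {z \<in> E. p (z - x) < e}"
  have o: "openin (prod_topology euclidean T) ?V"
    using a(2) cx by (intro openin_prod_Times_iff[THEN iffD2] disjI2 conjI openin_seminorm_ball) auto
  have m: "a \<in> ?V" using a cx seminorm_0[OF a(2)] d e by simp
  have bd: "p ((case b of (c, x) \<Rightarrow> smul c x) - (case a of (c, x) \<Rightarrow> smul c x)) < \<epsilon>"
    if b: "b \<in> ?V" for b
  proof -
    obtain c' x' where b': "b = (c', x')" by (cases b)
    then have V: "(c', x') \<in> ?V" using b by simp
    have c': "cmod (c' - c) \<le> d" using V by (auto simp: dist_norm norm_minus_commute)
    then have "cmod c' \<le> cmod c + 1" using d norm_triangle_ineq2[of c' c] by linarith
    then have 1: "cmod c' * p (x' - x) \<le> (cmod c + 1) * p (x' - x)"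
      using V cx a seminorm_nonneg by (intro mult_right_mono) auto
    have 2: "(cmod c + 1) * p (x' - x) < (cmod c + 1) * e"
      using V norm_ge_zero[of c] by (intro mult_strict_left_mono) (auto intro: add_nonneg_pos)
    have 3: "cmod (c' - c) * p x \<le> d * p x" using c' px by (intro mult_right_mono)
    have "smul c' x' - smul c x = smul c' (x' - x) + smul (c' - c) x"
      by (simp add: algebra_simps)
    then have "p (smul c' x' - smul c x) \<le> cmod c' * p (x' - x) + cmod (c' - c) * p x"
      using seminorm_add[of p "smul c' (x' - x)" "smul (c' - c) x"] V a cx
      by (simp add: seminorm_scale)
    then have "p (smul c' x' - smul c x) < \<epsilon>" using 1 2 3 d e by linarith
    then show ?thesis unfolding b' cx(1) prod.case .
  qed
  show "\<exists>V. openin (prod_topology euclidean T) V \<and> a \<in> V \<and>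
      (\<forall>b\<in>V. p ((case b of (c, x) \<Rightarrow> smul c x) - (case a of (c, x) \<Rightarrow> smul c x)) < \<epsilon>)"
    using o m bd by (intro exI[of _ ?V] conjI ballI)
qed

lemma convex_seminorm_ball:
  assumes "x \<in> E" "p \<in> P"
  shows "convex_wrt smul {y \<in> E. p (y - x) < \<epsilon>}"
  unfolding convex_wrt_def
proof safe
  fix y z and t :: real
  assume yz: "y \<in> E" "z \<in> E" "p (y - x) < \<epsilon>" "p (z - x) < \<epsilon>" and t: "0 \<le> t" "t \<le> 1"
  let ?s = "smul (of_real (1 - t)) y + smul (of_real t) z"
  show "?s \<in> E" using yz by simp
  have "smul (of_real (1 - t)) x + smul (of_real t) x = x"
    by (simp flip: scale_left_distrib)
  then have "?s - x = smul (of_real (1 - t)) (y - x) + smul (of_real t) (z - x)"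
    by (metis (no_types, lifting) add_diff_add scale_right_diff_distrib)
  then have "p (?s - x) \<le> cmod (of_real (1 - t)) * p (y - x) + cmod (of_real t) * p (z - x)"
    using seminorm_add[OF assms(2), of "smul (of_real (1 - t)) (y - x)" "smul (of_real t) (z - x)"] assms yz
    by (simp only: seminorm_scale mem_E)
  also have "\<dots> = (1 - t) * p (y - x) + t * p (z - x)"
    using t by (simp only: norm_of_real abs_of_nonneg diff_ge_0_iff_ge)
  also have "\<dots> < \<epsilon>"
    using convex_bound_lt[of "p (y - x)" \<epsilon> "p (z - x)" "1 - t" t] yz t by simp
  finally show "p (?s - x) < \<epsilon>" .
qed

lemma locally_convex_topology: "locally_convex_topology smul E T"
proof -
  let ?B = "{{y \<in> E. p (y - x) < \<epsilon>} | x p \<epsilon>. x \<in> E \<and> p \<in> P \<and> 0 < \<epsilon>}"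
  \<comment> \<open>Induction over the generation of open sets. A subbasic ball containing 0 is
    itself convex, even if centred elsewhere, so it serves as its own \<open>W\<close>;
    intersections preserve convexity.\<close>
  have "\<exists>W. openin T W \<and> 0 \<in> W \<and> W \<subseteq> U \<and> convex_wrt smul W"
    if "generate_topology_on ?B U" "0 \<in> U" for U
    using that
  proof induction
    case (Int a b)
    then obtain V W where "openin T V" "0 \<in> V" "V \<subseteq> a" "convex_wrt smul V"
      "openin T W" "0 \<in> W" "W \<subseteq> b" "convex_wrt smul W" by auto
    then show ?case
      by (intro exI[of _ "V \<inter> W"]) (auto simp: convex_wrt_def openin_Int)
  next
    case (UN K)
    then obtain k where "k \<in> K" "0 \<in> k" by auto
    then show ?case using UN.IH by (meson Union_upper subset_trans)
  next
    case (Basis U)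
    then obtain x p \<epsilon> where "U = {y \<in> E. p (y - x) < \<epsilon>}" "x \<in> E" "p \<in> P" by auto
    then show ?case
      using Basis openin_seminorm_ball convex_seminorm_ball by (intro exI[of _ U]) auto
  qed auto
  then have "\<forall>U. openin T U \<and> 0 \<in> U \<longrightarrow>
      (\<exists>W. openin T W \<and> 0 \<in> W \<and> W \<subseteq> U \<and> convex_wrt smul W)"
    unfolding seminorm_topology_def openin_topology_generated_by_iff by blast
  then show ?thesis
    unfolding locally_convex_topology_def
    using vector_space_axioms subspace_E continuous_map_add continuous_map_scale
    by (intro conjI topspace_seminorm_topology)
qed

lemma Hausdorff_seminorm_topology:
  assumes "\<And>x. x \<in> E \<Longrightarrow> x \<noteq> 0 \<Longrightarrow> \<exists>p\<in>P. 0 < p x"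
  shows "Hausdorff_space T"
  unfolding Hausdorff_space_def topspace_seminorm_topology
proof (intro allI impI, elim conjE)
  fix x y assume xy: "x \<in> E" "y \<in> E" "x \<noteq> y"
  then obtain p where p: "p \<in> P" "0 < p (x - y)" using assms[of "x - y"] by auto
  let ?U = "{z \<in> E. p (z - x) < p (x - y) / 2}" and ?V = "{z \<in> E. p (z - y) < p (x - y) / 2}"
  have "z \<notin> ?V" if "z \<in> ?U" for z
    using that seminorm_triangle[of p x z y] seminorm_minus_commute[of p x z] p xy by auto
  then show "\<exists>U V. openin T U \<and> openin T V \<and> x \<in> U \<and> y \<in> V \<and> disjnt U V"
    using xy p openin_seminorm_ball
    by (intro exI[of _ ?U] exI[of _ ?V]) (simp add: disjnt_iff seminorm_0[OF p(1)] del: less_divide_eq_numeral1)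
qed

text \<open>It suffices to test convergence on the subbasis, and a subbasic ball with another centre
  \<open>a\<close> still contains the ball of radius \<epsilon> - p (x - a) around the limit
  \<open>x\<close>.\<close>

lemma limitin_seminorm_topology:
  assumes "x \<in> E" "\<And>n. s n \<in> E" "\<And>p. p \<in> P \<Longrightarrow> ((\<lambda>n. p (s n - x)) \<longlongrightarrow> 0) F"
  shows "limitin T s x F"
proof -
  let ?B = "{{y \<in> E. p (y - x) < \<epsilon>} | x p \<epsilon>. x \<in> E \<and> p \<in> P \<and> 0 < \<epsilon>}"
  have "\<forall>\<^sub>F n in F. s n \<in> U" if "generate_topology_on ?B U" "x \<in> U" for U
    using that
  proof induction
    case (Int a b)
    then show ?case by (auto intro: eventually_conj)
  next
    case (UN K)
    then obtain k where "k \<in> K" "x \<in> k" by auto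
    then show ?case using UN.IH[of k] by (auto elim: eventually_mono)
  next
    case (Basis U)
    then obtain a p \<epsilon> where U: "U = {y \<in> E. p (y - a) < \<epsilon>}" "a \<in> E" "p \<in> P" by auto
    then have "0 < \<epsilon> - p (x - a)" using Basis by auto
    then have "\<forall>\<^sub>F n in F. p (s n - x) < \<epsilon> - p (x - a)"
      using order_tendstoD(2)[OF assms(3)[OF U(3)]] by blast
    then show ?case
    proof eventually_elim
      case (elim n)
      then show ?case using seminorm_triangle[OF U(3) assms(2)[of n] assms(1) U(2)] U assms(2)[of n] by simp
    qed
  qed auto
  then show ?thesis
    using assms(1) topspace_seminorm_topology
    unfolding limitin_def seminorm_topology_def openin_topology_generated_by_iff by blast
qed

lemma continuous_map_linear_form:
  assumes u: "linear_form_on smul E u" and p: "p \<in> P" and C: "\<And>x. x \<in> E \<Longrightarrow> cmod (u x) \<le> C * p x"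
  shows "continuous_map T euclidean u"
proof -
  have "openin T {x \<in> E. u x \<in> U}" if "open U" for U
  proof (subst openin_subopen, rule ballI)
    fix a assume a: "a \<in> {x \<in> E. u x \<in> U}"
    then obtain \<epsilon> where \<epsilon>: "0 < \<epsilon>" "ball (u a) \<epsilon> \<subseteq> U" using \<open>open U\<close> open_contains_ball by blast
    \<comment> \<open>Replacing \<open>C\<close> by |C| + 1 gives a positive divisor whatever the
      sign of \<open>C\<close>.\<close>
    let ?V = "{x \<in> E. p (x - a) < \<epsilon> / (\<bar>C\<bar> + 1)}"
    have "u x \<in> U" if x: "x \<in> ?V" for x
    proof -
      have xa: "x - a \<in> E" using x a by simp
      have "u x = u ((x - a) + a)" by simp
      also have "\<dots> = u (x - a) + u a"
        using u xa a unfolding linear_form_on_def by blast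
      finally have "cmod (u x - u a) \<le> C * p (x - a)" using C[OF xa] by simp
      also have "\<dots> \<le> (\<bar>C\<bar> + 1) * p (x - a)"
        using seminorm_nonneg[OF p xa] by (intro mult_right_mono) auto
      also have "\<dots> < \<epsilon>" using x by (simp add: field_simps)
      finally show ?thesis using \<epsilon> by (auto simp: dist_norm norm_minus_commute)
    qed
    then show "\<exists>V. openin T V \<and> a \<in> V \<and> V \<subseteq> {x \<in> E. u x \<in> U}"
      using a p \<epsilon> openin_seminorm_ball
      by (intro exI[of _ ?V]) (auto simp: seminorm_0[OF p] intro!: divide_pos_pos add_nonneg_pos)
  qed
  then show ?thesis by (simp add: continuous_map_def)
qed

end

section \<open>A biorthogonality criterion for Schauder bases\<close>

lemma schauder_basis_biorthogonal:
  assumes T: "locally_convex_space smul E T"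
    and b: "\<And>n. b n \<in> E"
    and u: "\<And>n. linear_form_on smul E (u n)" "\<And>n. continuous_map T euclidean (u n)"
    and ub: "\<And>m n. u m (b n) = (if m = n then 1 else 0)"
    and conv: "\<And>x. x \<in> E \<Longrightarrow> limitin T (\<lambda>N. \<Sum>n<N. smul (u n x) (b n)) x sequentially"
  shows "schauder_basis smul E T b"
proof -
  interpret vector_space smul
    using T by (simp add: locally_convex_space_def locally_convex_topology_def)
  have sub: "subspace E"
    using T by (simp add: locally_convex_space_def locally_convex_topology_def)
  have sumE: "(\<Sum>n<N. smul (c n) (b n)) \<in> E" for c and N :: nat
    using b by (intro subspace_sum[OF sub] subspace_scale[OF sub])
  have u0: "u m 0 = 0" for m
    using u(1)[of m] b[of 0] unfolding linear_form_on_def by (metis mult_zero_left scale_zero_left)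
  have u_sum: "u m (\<Sum>n<N. smul (c n) (b n)) = (\<Sum>n<N. c n * (if m = n then 1 else 0))" for c m and N :: nat
  proof (induction N)
    case (Suc N)
    have "u m ((\<Sum>n<N. smul (c n) (b n)) + smul (c N) (b N)) =
        u m (\<Sum>n<N. smul (c n) (b n)) + c N * u m (b N)"
      using u(1)[of m] sumE b subspace_scale[OF sub] unfolding linear_form_on_def by metis
    then show ?case using Suc by (simp add: ub)
  qed (simp add: u0)
  \<comment> \<open>Uniqueness of the coefficients: by biorthogonality \<open>u m\<close> has the
    value \<open>c m\<close> on all partial sums with N > m, and by continuity these values converge
    to \<open>u m x\<close>.\<close>
  have "c m = u m x" if "limitin T (\<lambda>N. \<Sum>n<N. smul (c n) (b n)) x sequentially" for c m x
  proof -
    have "(\<lambda>N. u m (\<Sum>n<N. smul (c n) (b n))) \<longlonglongrightarrow> u m x"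
      using continuous_map_limit[OF u(2) that] by (simp add: o_def)
    moreover have "\<forall>\<^sub>F N in sequentially. u m (\<Sum>n<N. smul (c n) (b n)) = c m"
      using eventually_gt_at_top[of m] by eventually_elim (simp add: u_sum if_distrib cong: if_cong)
    ultimately have "(\<lambda>N. c m) \<longlonglongrightarrow> u m x" by (simp cong: tendsto_cong)
    then show ?thesis using LIMSEQ_unique by blast
  qed
  then show ?thesis
    unfolding schauder_basis_def using T b u conv by blast
qed

section \<open>Growth spaces and Taylor coefficients\<close>

lemma M_infty_upper: "ennreal (cmod (f z)) \<le> M_infty f (cmod z)"
  unfolding M_infty_def by (rule SUP_upper) simp

text \<open>Together with \<open>growth_norm_least\<close> this collapses the iterated supremum,
  over radii and over circles, into one weighted pointwise bound on the disc, the form in which all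
  later estimates are made.\<close>

lemma growth_norm_upper:
  assumes "z \<in> ball 0 1"
  shows "ennreal (cmod (f z) * (1 - cmod z) powr \<mu>) \<le> growth_norm \<mu> f"
proof -
  have "ennreal (cmod (f z) * (1 - cmod z) powr \<mu>) \<le> M_infty f (cmod z) * ennreal ((1 - cmod z) powr \<mu>)"
    using M_infty_upper by (simp add: ennreal_mult mult_right_mono)
  also have "\<dots> \<le> growth_norm \<mu> f"
    unfolding growth_norm_def by (rule SUP_upper) (use assms in simp)
  finally show ?thesis .
qed

text \<open>Membership in the space matters: \<open>enn2real\<close> sends the infinite value to
  0.\<close>

lemma growth_norm_real_upper:
  assumes "f \<in> growth_space \<mu>" "z \<in> ball 0 1"
  shows "cmod (f z) * (1 - cmod z) powr \<mu> \<le> growth_norm_real \<mu> f"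
proof -
  have "enn2real (ennreal (cmod (f z) * (1 - cmod z) powr \<mu>)) \<le> enn2real (growth_norm \<mu> f)"
    using assms by (intro enn2real_mono growth_norm_upper) (auto simp: growth_space_def)
  then show ?thesis by (simp add: growth_norm_real_def)
qed

lemma growth_norm_least:
  assumes "\<And>z. z \<in> ball 0 1 \<Longrightarrow> cmod (f z) * (1 - cmod z) powr \<mu> \<le> M"
  shows "growth_norm \<mu> f \<le> ennreal M"
  unfolding growth_norm_def
proof (rule SUP_least)
  fix r :: real assume r: "r \<in> {0..<1}"
  have "M_infty f r * ennreal ((1 - r) powr \<mu>) = (SUP z\<in>sphere 0 r. ennreal (cmod (f z)) * ennreal ((1 - r) powr \<mu>))"
    unfolding M_infty_def by (rule SUP_mult_right_ennreal)
  also have "\<dots> \<le> ennreal M"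
  proof (rule SUP_least)
    fix z :: complex assume "z \<in> sphere 0 r"
    then show "ennreal (cmod (f z)) * ennreal ((1 - r) powr \<mu>) \<le> ennreal M"
      using assms[of z] r by (auto simp flip: ennreal_mult intro!: ennreal_leI)
  qed
  finally show "M_infty f r * ennreal ((1 - r) powr \<mu>) \<le> ennreal M" .
qed

lemma growth_norm_real_nonneg: "0 \<le> growth_norm_real \<mu> f"
  by (simp add: growth_norm_real_def)

lemma growth_norm_real_least:
  assumes "\<And>z. z \<in> ball 0 1 \<Longrightarrow> cmod (f z) * (1 - cmod z) powr \<mu> \<le> M"
  shows "growth_norm_real \<mu> f \<le> M"
proof -
  \<comment> \<open>The weight at the origin is 1, which forces M \<ge> 0; only then does
    \<open>enn2real\<close> recover \<open>M\<close> from \<open>ennreal M\<close>.\<close>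
  have "cmod (f 0) \<le> M" using assms[of 0] by simp
  then have "0 \<le> M" using norm_ge_zero order_trans by blast
  have "enn2real (growth_norm \<mu> f) \<le> enn2real (ennreal M)"
    using assms by (intro enn2real_mono growth_norm_least) auto
  then show ?thesis using \<open>0 \<le> M\<close> by (simp add: growth_norm_real_def)
qed

lemma growth_spaceI:
  assumes "f holomorphic_on ball 0 1" "\<And>z. z \<notin> ball 0 1 \<Longrightarrow> f z = 0"
    and "\<And>z. z \<in> ball 0 1 \<Longrightarrow> cmod (f z) * (1 - cmod z) powr \<mu> \<le> M"
  shows "f \<in> growth_space \<mu>"
proof -
  have "growth_norm \<mu> f < \<infinity>"
    using growth_norm_least[OF assms(3)] ennreal_less_top[of M] by (auto intro: le_less_trans)
  then show ?thesis using assms(1,2) by (simp add: growth_space_def analytic_on_open)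
qed

lemma growth_space_holomorphic: "f \<in> growth_space \<mu> \<Longrightarrow> f holomorphic_on ball 0 1"
  by (simp add: growth_space_def analytic_on_open)

lemma growth_space_eq_0: "f \<in> growth_space \<mu> \<Longrightarrow> z \<notin> ball 0 1 \<Longrightarrow> f z = 0"
  by (auto simp: growth_space_def)

lemma growth_space_add:
  assumes "f \<in> growth_space \<mu>" "g \<in> growth_space \<mu>"
  shows "f + g \<in> growth_space \<mu>"
    and "growth_norm_real \<mu> (f + g) \<le> growth_norm_real \<mu> f + growth_norm_real \<mu> g"
proof -
  have bd: "cmod ((f + g) z) * (1 - cmod z) powr \<mu> \<le> growth_norm_real \<mu> f + growth_norm_real \<mu> g"
    if "z \<in> ball 0 1" for z
  proof -
    have "cmod ((f + g) z) * (1 - cmod z) powr \<mu> \<le> (cmod (f z) + cmod (g z)) * (1 - cmod z) powr \<mu>"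
      by (intro mult_right_mono) (auto intro: norm_triangle_ineq)
    then show ?thesis
      using growth_norm_real_upper[OF assms(1) that] growth_norm_real_upper[OF assms(2) that]
      by (simp add: distrib_right)
  qed
  show "growth_norm_real \<mu> (f + g) \<le> growth_norm_real \<mu> f + growth_norm_real \<mu> g"
    by (rule growth_norm_real_least) (rule bd)
  show "f + g \<in> growth_space \<mu>"
  proof (rule growth_spaceI[OF _ _ bd])
    show "f + g holomorphic_on ball 0 1"
      unfolding plus_fun_def using assms by (intro holomorphic_intros growth_space_holomorphic)
  qed (simp add: growth_space_eq_0[OF assms(1)] growth_space_eq_0[OF assms(2)])
qed

lemma growth_space_scale:
  assumes f: "f \<in> growth_space \<mu>"
  shows "fun_scale c f \<in> growth_space \<mu>"
    and "growth_norm_real \<mu> (fun_scale c f) = cmod c * growth_norm_real \<mu> f"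
proof -
  have bd: "cmod (fun_scale c f z) * (1 - cmod z) powr \<mu> \<le> cmod c * growth_norm_real \<mu> f"
    if f: "f \<in> growth_space \<mu>" and z: "z \<in> ball 0 1" for c f z
    using growth_norm_real_upper[OF f z] by (simp add: fun_scale_def norm_mult mult.assoc mult_left_mono)
  have mem: "fun_scale c f \<in> growth_space \<mu>" if f: "f \<in> growth_space \<mu>" for c f
  proof (rule growth_spaceI[OF _ _ bd[OF f]])
    show "fun_scale c f holomorphic_on ball 0 1"
      unfolding fun_scale_def using f by (intro holomorphic_intros growth_space_holomorphic)
  qed (use f growth_space_eq_0 in \<open>auto simp: fun_scale_def\<close>)
  have le: "growth_norm_real \<mu> (fun_scale c f) \<le> cmod c * growth_norm_real \<mu> f"
    if "f \<in> growth_space \<mu>" for c f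
    by (rule growth_norm_real_least) (rule bd[OF that])
  show "fun_scale c f \<in> growth_space \<mu>" using mem[OF f] .
  show "growth_norm_real \<mu> (fun_scale c f) = cmod c * growth_norm_real \<mu> f"
  proof (cases "c = 0")
    case True
    then show ?thesis using le[OF f, of c] growth_norm_real_nonneg[of \<mu> "fun_scale c f"] by simp
  next
    case False
    \<comment> \<open>The reverse inequality is the upper bound \<open>le\<close> again, applied to
      the factor 1/c and the function c f.\<close>
    then have "fun_scale (inverse c) (fun_scale c f) = f"
      by (simp add: fun_scale_def fun_eq_iff)
    then have "growth_norm_real \<mu> f \<le> cmod (inverse c) * growth_norm_real \<mu> (fun_scale c f)"
      using le[OF mem[OF f], of "inverse c" c] by simp
    then have "cmod c * growth_norm_real \<mu> f \<le> cmod c * (cmod (inverse c) * growth_norm_real \<mu> (fun_scale c f))"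
      by (rule mult_left_mono) simp
    also have "\<dots> = growth_norm_real \<mu> (fun_scale c f)" using False by (simp add: norm_inverse)
    finally have "cmod c * growth_norm_real \<mu> f \<le> growth_norm_real \<mu> (fun_scale c f)" .
    then show ?thesis using le[OF f, of c] by simp
  qed
qed

lemma growth_space_0: "0 \<in> growth_space \<mu>"
  by (rule growth_spaceI[of _ _ 0]) (auto simp: zero_fun_def)

lemma growth_space_mono:
  assumes "f \<in> growth_space \<mu>" "\<mu> \<le> \<nu>"
  shows "f \<in> growth_space \<nu>" and "growth_norm_real \<nu> f \<le> growth_norm_real \<mu> f"
proof -
  have bd: "cmod (f z) * (1 - cmod z) powr \<nu> \<le> growth_norm_real \<mu> f" if z: "z \<in> ball 0 1" for z
  proof -
    have "cmod (f z) * (1 - cmod z) powr \<nu> \<le> cmod (f z) * (1 - cmod z) powr \<mu>"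
      using z assms by (intro mult_left_mono powr_mono') auto
    then show ?thesis using growth_norm_real_upper[OF assms(1) z] by linarith
  qed
  show "f \<in> growth_space \<nu>"
    using assms growth_space_eq_0 by (intro growth_spaceI[OF _ _ bd] growth_space_holomorphic) auto
  show "growth_norm_real \<nu> f \<le> growth_norm_real \<mu> f" by (rule growth_norm_real_least) (rule bd)
qed

lemma growth_norm_real_pos:
  assumes "f \<in> growth_space \<mu>" "f \<noteq> 0"
  shows "0 < growth_norm_real \<mu> f"
proof -
  obtain z where z: "f z \<noteq> 0" using assms(2) by (auto simp: fun_eq_iff)
  then have z1: "z \<in> ball 0 1" using growth_space_eq_0[OF assms(1)] by blast
  then have "0 < cmod (f z) * (1 - cmod z) powr \<mu>" using z by simp
  then show ?thesis using growth_norm_real_upper[OF assms(1) z1] by linarith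
qed

lemma seminorm_on_growth_norm_real: "E \<subseteq> growth_space \<mu> \<Longrightarrow> seminorm_on fun_scale E (growth_norm_real \<mu>)"
  unfolding seminorm_on_def using growth_space_add(2) growth_space_scale(2) by blast

lemma vector_space_fun_scale: "vector_space fun_scale"
  by unfold_locales (auto simp: fun_scale_def fun_eq_iff algebra_simps)

lemma subspace_growth_space: "module.subspace fun_scale (growth_space \<mu>)"
proof -
  interpret vector_space fun_scale by (rule vector_space_fun_scale)
  show ?thesis by (intro subspaceI growth_space_0 growth_space_add growth_space_scale)
qed

section \<open>Taylor coefficients at the origin\<close>

definition taylor_coeff :: "nat \<Rightarrow> (complex \<Rightarrow> complex) \<Rightarrow> complex" where
  "taylor_coeff n f = (deriv ^^ n) f 0 / fact n"

text \<open>Cauchy's inequality on the circle of radius 1/2, where the weight is (1/2)^\<mu>. The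
  bound is linear in the norm, as continuity of the coefficient forms requires.\<close>

lemma norm_taylor_coeff_le:
  assumes f: "f \<in> growth_space \<mu>"
  shows "cmod (taylor_coeff n f) \<le> 2 ^ n * 2 powr \<mu> * growth_norm_real \<mu> f"
proof -
  have hol: "f holomorphic_on ball 0 1" using growth_space_holomorphic[OF f] .
  have "cmod (f z) \<le> 2 powr \<mu> * growth_norm_real \<mu> f" if "cmod (0 - z) = 1 / 2" for z
  proof -
    have z: "cmod z = 1 / 2" using that by simp
    have "cmod (f z) * (1 / 2) powr \<mu> \<le> growth_norm_real \<mu> f"
      using growth_norm_real_upper[OF f, of z] by (simp add: z)
    then show ?thesis by (simp add: powr_divide field_simps)
  qed
  then have "cmod ((deriv ^^ n) f 0) \<le> fact n * (2 powr \<mu> * growth_norm_real \<mu> f) / (1 / 2) ^ n"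
    by (intro Cauchy_inequality)
       (auto intro!: holomorphic_on_subset[OF hol] holomorphic_on_imp_continuous_on)
  then show ?thesis by (simp add: taylor_coeff_def norm_divide field_simps)
qed

lemma taylor_coeff_linear:
  assumes "f \<in> growth_space \<mu>"
  shows "g \<in> growth_space \<mu> \<Longrightarrow> taylor_coeff n (f + g) = taylor_coeff n f + taylor_coeff n g"
    and "taylor_coeff n (fun_scale c f) = c * taylor_coeff n f"
  using assms unfolding taylor_coeff_def plus_fun_def fun_scale_def
  by (auto simp: higher_deriv_add[OF growth_space_holomorphic growth_space_holomorphic]
      higher_deriv_cmult[OF growth_space_holomorphic] add_divide_distrib)

lemma taylor_coeff_monomial: "taylor_coeff m (monomial n) = (if m = n then 1 else 0)"
proof -
  have "(deriv ^^ m) (monomial n) 0 = (deriv ^^ m) (\<lambda>w. (w - 0) ^ n) 0"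
    by (rule higher_deriv_cong_ev)
       (auto simp: monomial_def eventually_nhds intro!: exI[of _ "ball 0 1"])
  also have "\<dots> = pochhammer (of_nat (Suc n - m)) m * 0 ^ (n - m)"
    by (subst higher_deriv_power) simp
  also have "\<dots> = (if m = n then fact n else 0)"
  proof (cases m n rule: linorder_cases)
    \<comment> \<open>For m > n the natural difference \<open>Suc n - m\<close> is 0 and the
      Pochhammer factor vanishes; for m < n the power of 0 does.\<close>
    case greater
    then have "Suc n - m = 0" "m > 0" by auto
    then show ?thesis using greater by (simp add: pochhammer_0_left)
  qed (auto simp: pochhammer_fact)
  finally show ?thesis by (simp add: taylor_coeff_def)
qed

lemma monomial_in_growth_space:
  assumes "0 \<le> \<mu>"
  shows "monomial n \<in> growth_space \<mu>"
proof (rule growth_spaceI[where M = 1])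
  show "monomial n holomorphic_on ball 0 1"
    by (rule holomorphic_transform[of "\<lambda>z. z ^ n"]) (auto simp: monomial_def intro!: holomorphic_intros)
next
  fix z :: complex assume z: "z \<in> ball 0 1"
  have "cmod z ^ n * (1 - cmod z) powr \<mu> \<le> 1 * 1"
    using z assms by (intro mult_mono power_le_one powr_le1) auto
  then show "cmod (monomial n z) * (1 - cmod z) powr \<mu> \<le> 1"
    using z by (simp add: monomial_def norm_power)
qed (simp add: monomial_def)

lemma sum_monomial:
  "(\<Sum>n<N. fun_scale (c n) (monomial n)) z = (if z \<in> ball 0 1 then \<Sum>n<N. c n * z ^ n else 0)"
  by (induction N) (auto simp: fun_scale_def monomial_def)

section \<open>The Taylor remainder\<close>

text \<open>Induction from Cauchy's formula at N = 0. Each step subtracts z^N f(w) / w^(N+1), whose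
  integral is the N-th Taylor term, and the integrands match because 1/(w - z) - 1/w = (z/w) / (w -
  z).\<close>

lemma taylor_remainder_contour_integral:
  assumes f: "f holomorphic_on ball 0 1" and R: "0 < R" "R < 1" and z: "cmod z < R"
  shows "((\<lambda>w. f w * (z / w) ^ N / (w - z)) has_contour_integral
           2 * pi * \<i> * (f z - (\<Sum>n<N. taylor_coeff n f * z ^ n))) (circlepath 0 R)"
proof -
  have hol: "f holomorphic_on ball 0 R" "continuous_on (cball 0 R) f"
    using R by (auto intro!: holomorphic_on_subset[OF f] holomorphic_on_imp_continuous_on)
  show ?thesis
  proof (induction N)
    case 0
    show ?case
      using Cauchy_integral_circlepath[OF hol(2,1)] z by simp
  next
    case (Suc N)
    have "((\<lambda>w. f w / (w - 0) ^ Suc N) has_contour_integral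
        2 * pi * \<i> / fact N * (deriv ^^ N) f 0) (circlepath 0 R)"
      using Cauchy_has_contour_integral_higher_derivative_circlepath[OF hol(2,1), of 0 N] R by simp
    then have "((\<lambda>w. z ^ N * (f w / (w - 0) ^ Suc N)) has_contour_integral
        z ^ N * (2 * pi * \<i> / fact N * (deriv ^^ N) f 0)) (circlepath 0 R)"
      by (rule has_contour_integral_lmul)
    from has_contour_integral_diff[OF Suc this]
    have "((\<lambda>w. f w * (z / w) ^ N / (w - z) - z ^ N * (f w / (w - 0) ^ Suc N)) has_contour_integral
        2 * pi * \<i> * (f z - (\<Sum>n<Suc N. taylor_coeff n f * z ^ n))) (circlepath 0 R)"
      by (simp add: taylor_coeff_def algebra_simps)
    then show ?case
    proof (rule has_contour_integral_eq)
      fix w assume "w \<in> path_image (circlepath 0 R)"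
      then have "cmod w = R" using R by simp
      then have "w \<noteq> 0" "w - z \<noteq> 0" using R z by auto
      then show "f w * (z / w) ^ N / (w - z) - z ^ N * (f w / (w - 0) ^ Suc N) = f w * (z / w) ^ Suc N / (w - z)"
        by (simp add: divide_simps) (simp add: algebra_simps)
    qed
  qed
qed

section \<open>Size and integral of the Cauchy kernel on a circle\<close>

lemma sin_ge_third:
  assumes "0 \<le> x" "x \<le> 2"
  shows "x / 3 \<le> sin (x::real)"
proof -
  have "\<bar>sin x - x\<bar> \<le> x ^ 3 / 6"
  proof -
    have "(\<Sum>m<3. sin_coeff m * x ^ m) = x"
      by (simp add: sin_coeff_def numeral_3_eq_3)
    moreover have "inverse (fact 3) * \<bar>x\<bar> ^ 3 = x ^ 3 / 6"
      using assms by (simp add: fact_numeral)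
    ultimately show ?thesis using Maclaurin_sin_bound[of x 3] by simp
  qed
  \<comment> \<open>Hence the Maclaurin error x^3/6 is at most 2x/3, which leaves x/3.\<close>
  moreover have "x ^ 3 \<le> 4 * x"
    using mult_right_mono[OF power_mono[OF assms(2,1), of 2] assms(1)]
    by (simp add: power3_eq_cube power2_eq_square)
  ultimately show ?thesis by linarith
qed

text \<open>The chord has length 2 |sin (t/2)|. Beyond t = pi the reflection x \<mapsto> pi - x
  brings the argument back below pi/2, and pi/2 < 2 puts it in the range of
  \<open>sin_ge_third\<close>.\<close>

lemma cmod_cis_minus_1_ge:
  assumes "0 \<le> t" "t \<le> 2 * pi"
  shows "min t (2 * pi - t) / 3 \<le> cmod (cis t - 1)"
proof -
  have "cmod (cis t - 1) = 2 * \<bar>sin (t / 2)\<bar>"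
    using dist_exp_i_1[of t] by (simp add: cis_conv_exp)
  moreover have "min t (2 * pi - t) / 2 / 3 \<le> sin (t / 2)"
  proof (cases "t \<le> pi")
    case True
    then have "t / 2 / 3 \<le> sin (t / 2)"
      using assms pi_less_4 by (intro sin_ge_third) auto
    then show ?thesis using True by simp
  next
    case False
    then have "(pi - t / 2) / 3 \<le> sin (pi - t / 2)"
      using assms pi_less_4 by (intro sin_ge_third) auto
    then have "(pi - t / 2) / 3 \<le> sin (t / 2)" by (simp only: sin_pi_minus)
    then show ?thesis using False by simp
  qed
  ultimately show ?thesis by linarith
qed

text \<open>Let w = R cis t - \<rho> and let m be the distance of t from the nearer end of the
  interval. Then |w| \<ge> R - \<rho>, and R (cis t - 1) = w - (R - \<rho>) has modulus between m/6
  and 2 |w|, so also |w| \<ge> m/12. Averaging both bounds gives 24 / (12 (R - \<rho>) + m). Adding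
  the terms for both ends removes the minimum and leaves an integrand with an elementary
  antiderivative.\<close>

lemma cauchy_kernel_bound:
  fixes \<rho> R t :: real
  assumes "0 \<le> \<rho>" "\<rho> < R" "1 / 2 \<le> R" "0 \<le> t" "t \<le> 2 * pi"
  shows "1 / cmod (R * cis t - \<rho>) \<le> 24 / (12 * (R - \<rho>) + t) + 24 / (12 * (R - \<rho>) + (2 * pi - t))"
proof -
  define m where "m = min t (2 * pi - t)"
  have m: "0 \<le> m" using assms by (simp add: m_def)
  define w where "w = R * cis t - \<rho>"
  have "cmod (R * cis t) = R" "cmod (of_real \<rho>) = \<rho>" using assms by (simp_all add: norm_mult)
  then have 1: "R - \<rho> \<le> cmod w"
    using norm_triangle_ineq2[of "R * cis t" "of_real \<rho>"] unfolding w_def by linarith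
  have "R * (m / 3) \<le> R * cmod (cis t - 1)"
    using cmod_cis_minus_1_ge[of t] assms by (intro mult_left_mono) (auto simp: m_def)
  also have "\<dots> = cmod (R * (cis t - 1))"
    using assms by (simp only: norm_mult norm_of_real abs_of_nonneg)
  also have "R * (cis t - 1) = w - of_real (R - \<rho>)"
    by (simp add: w_def algebra_simps)
  also have "cmod \<dots> \<le> cmod w + cmod (of_real (R - \<rho>))"
    by (rule norm_triangle_ineq4)
  also have "cmod (of_real (R - \<rho>)) = R - \<rho>"
    using assms by (simp only: norm_of_real)
  also have "cmod w + (R - \<rho>) \<le> 2 * cmod w" using 1 by simp
  finally have "m / 12 \<le> cmod w"
    using mult_right_mono[of "1 / 2" R "m / 3"] m assms by linarith
  then have 2: "(R - \<rho> + m / 12) / 2 \<le> cmod w" using 1 by simp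
  have "1 / cmod w \<le> 1 / ((R - \<rho> + m / 12) / 2)"
  proof (rule divide_left_mono[OF 2])
    have "0 < (R - \<rho> + m / 12) / 2" using m assms by simp
    moreover from this have "0 < cmod w" using 2 by linarith
    ultimately show "0 < cmod w * ((R - \<rho> + m / 12) / 2)" by (intro mult_pos_pos)
  qed simp
  also have "\<dots> = 24 / (12 * (R - \<rho>) + m)"
  proof -
    define d where "d = R - \<rho> + m / 12"
    have "12 * (R - \<rho>) + m = 12 * d" by (simp add: d_def)
    moreover have "1 / (d / 2) = 24 / (12 * d)" by simp
    ultimately show ?thesis by (simp only: d_def)
  qed
  also have "\<dots> \<le> 24 / (12 * (R - \<rho>) + t) + 24 / (12 * (R - \<rho>) + (2 * pi - t))"
  proof (cases "t \<le> 2 * pi - t")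
    case True
    have "0 \<le> 24 / (12 * (R - \<rho>) + (2 * pi - t))"
      using assms by (intro divide_nonneg_nonneg) auto
    then show ?thesis using True unfolding m_def by (simp only: min_absorb1)
  next
    case False
    have "0 \<le> 24 / (12 * (R - \<rho>) + t)"
      using assms by (intro divide_nonneg_nonneg) auto
    then show ?thesis using False unfolding m_def by (simp only: min_absorb2 not_le less_imp_le)
  qed
  finally show ?thesis by (simp only: w_def)
qed

lemma cauchy_kernel_bound_integral:
  fixes c :: real
  assumes "0 < c"
  shows "((\<lambda>t. 24 / (c + t) + 24 / (c + (2 * pi - t))) has_integral 48 * ln ((c + 2 * pi) / c)) {0..2 * pi}"
proof -
  have "((\<lambda>t. 24 / (c + t) + 24 / (c + (2 * pi - t))) has_integral
      (24 * ln (c + 2 * pi) - 24 * ln (c + (2 * pi - 2 * pi))) -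
      (24 * ln (c + 0) - 24 * ln (c + (2 * pi - 0)))) {0..2 * pi}"
  proof (rule fundamental_theorem_of_calculus)
    fix t assume t: "t \<in> {0..2 * pi}"
    then have "0 < c + t" "0 < c + (2 * pi - t)"
      using assms by (auto intro: add_pos_nonneg)
    then have "((\<lambda>t. 24 * ln (c + t) - 24 * ln (c + (2 * pi - t))) has_real_derivative
        24 / (c + t) + 24 / (c + (2 * pi - t))) (at t within {0..2 * pi})"
      by (auto intro!: derivative_eq_intros)
    then show "((\<lambda>t. 24 * ln (c + t) - 24 * ln (c + (2 * pi - t))) has_vector_derivative
        24 / (c + t) + 24 / (c + (2 * pi - t))) (at t within {0..2 * pi})"
      by (simp add: has_real_derivative_iff_has_vector_derivative)
  qed simp
  moreover
  have "ln ((c + 2 * pi) / c) = ln (c + 2 * pi) - ln c"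
    using assms pi_gt_zero by (intro ln_divide_pos add_pos_pos) auto
  then have "48 * ln ((c + 2 * pi) / c) = (24 * ln (c + 2 * pi) - 24 * ln (c + (2 * pi - 2 * pi))) -
      (24 * ln (c + 0) - 24 * ln (c + (2 * pi - 0)))"
    by simp
  ultimately show ?thesis by (simp only:)
qed

text \<open>On the circle of radius R = (1 + \<rho>)/2, midway between \<rho> and the unit circle,
  |\<rho>/w| is constant, so only the kernel has to be integrated. Here R - \<rho> = (1 - \<rho>)/2,
  whence the logarithm of 1/(1 - \<rho>).\<close>

lemma taylor_remainder_bound_real:
  fixes \<rho> B :: real
  assumes f: "f holomorphic_on ball 0 1" and \<rho>: "0 \<le> \<rho>" "\<rho> < 1"
    and B: "\<And>w. cmod w = (1 + \<rho>) / 2 \<Longrightarrow> cmod (f w) \<le> B"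
  shows "cmod (f \<rho> - (\<Sum>n<N. taylor_coeff n f * \<rho> ^ n))
           \<le> 8 * B * (2 * \<rho> / (1 + \<rho>)) ^ N * ln (4 / (1 - \<rho>))"
proof -
  define R where "R = (1 + \<rho>) / 2"
  have R: "0 < R" "R < 1" "\<rho> < R" "1 / 2 \<le> R" using \<rho> by (auto simp: R_def)
  have "cmod (f R) \<le> B" by (rule B) (use R in \<open>simp flip: R_def\<close>)
  then have B0: "0 \<le> B" using norm_ge_zero order_trans by blast
  let ?I = "2 * pi * \<i> * (f \<rho> - (\<Sum>n<N. taylor_coeff n f * \<rho> ^ n))"
  let ?h = "\<lambda>t. f (R * cis t) * (\<rho> / (R * cis t)) ^ N / (R * cis t - \<rho>) * R * \<i> * cis t"
  let ?c = "12 * (R - \<rho>)"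
  let ?k = "\<lambda>t. 24 / (?c + t) + 24 / (?c + (2 * pi - t))"
  have "((\<lambda>w. f w * (\<rho> / w) ^ N / (w - \<rho>)) has_contour_integral ?I) (part_circlepath 0 R 0 (2 * pi))"
    using taylor_remainder_contour_integral[OF f R(1,2), of \<rho> N] R \<rho> by (simp add: circlepath_def)
  then have I: "(?h has_integral ?I) {0..2 * pi}"
    by (subst (asm) has_contour_integral_part_circlepath_iff) simp_all
  have k: "(?k has_integral 48 * ln ((?c + 2 * pi) / ?c)) {0..2 * pi}"
    using R by (intro cauchy_kernel_bound_integral) simp
  have bd: "cmod (?h t) \<le> B * (\<rho> / R) ^ N * ?k t" if t: "t \<in> {0..2 * pi}" for t
  proof -
    have "cmod (?h t) = cmod (f (R * cis t)) * (\<rho> / R) ^ N * (R * (1 / cmod (R * cis t - \<rho>)))"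
      using R \<rho> by (simp add: norm_mult norm_divide norm_power)
    \<comment> \<open>The factor R from the line element is bounded by 1.\<close>
    also have "\<dots> \<le> B * (\<rho> / R) ^ N * (1 * ?k t)"
    proof (rule mult_mono)
      have "cmod (f (R * cis t)) \<le> B"
        by (rule B) (use R in \<open>simp add: norm_mult flip: R_def\<close>)
      then show "cmod (f (R * cis t)) * (\<rho> / R) ^ N \<le> B * (\<rho> / R) ^ N"
        using R \<rho> by (intro mult_right_mono) simp_all
      show "R * (1 / cmod (R * cis t - \<rho>)) \<le> 1 * ?k t"
        using R \<rho> t by (intro mult_mono cauchy_kernel_bound) simp_all
    qed (use R \<rho> B0 in simp_all)
    finally show ?thesis by simp
  qed
  have "cmod ?I \<le> B * (\<rho> / R) ^ N * (48 * ln ((?c + 2 * pi) / ?c))"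
  proof -
    note k' = has_integral_mult_right[OF k, of "B * (\<rho> / R) ^ N"]
    show ?thesis
      using integral_norm_bound_integral[OF has_integral_integrable[OF I] has_integral_integrable[OF k'] bd]
      unfolding integral_unique[OF I] integral_unique[OF k'] .
  qed
  also have "\<dots> \<le> B * (\<rho> / R) ^ N * (48 * ln (4 / (1 - \<rho>)))"
  proof -
    have d: "?c = 6 * (1 - \<rho>)" by (simp add: R_def field_simps)
    \<comment> \<open>The numerator is below 6 + 8; the larger value 24 is taken because 24 /
      \<open>?c\<close> is exactly 4 / (1 - \<rho>).\<close>
    have "(?c + 2 * pi) / ?c \<le> 24 / ?c"
      using \<rho> pi_less_4 unfolding d by (intro divide_right_mono) auto
    also have "\<dots> = 4 / (1 - \<rho>)" unfolding d using \<rho> by (simp add: divide_simps)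
    finally have "ln ((?c + 2 * pi) / ?c) \<le> ln (4 / (1 - \<rho>))"
      using R by (intro ln_mono) (auto intro!: divide_pos_pos add_pos_pos)
    then show ?thesis using B0 R \<rho> by (intro mult_left_mono) auto
  qed
  finally have "2 * pi * cmod (f \<rho> - (\<Sum>n<N. taylor_coeff n f * \<rho> ^ n)) \<le> B * (\<rho> / R) ^ N * (48 * ln (4 / (1 - \<rho>)))"
    by (simp add: norm_mult)
  \<comment> \<open>With 2 pi > 6 the constant 48 turns into 48/6 = 8.\<close>
  moreover have "6 * cmod (f \<rho> - (\<Sum>n<N. taylor_coeff n f * \<rho> ^ n))
      \<le> 2 * pi * cmod (f \<rho> - (\<Sum>n<N. taylor_coeff n f * \<rho> ^ n))"
    using pi_gt3 by (intro mult_right_mono) auto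
  ultimately have "cmod (f \<rho> - (\<Sum>n<N. taylor_coeff n f * \<rho> ^ n))
      \<le> B * (\<rho> / R) ^ N * (48 * ln (4 / (1 - \<rho>))) / 6"
    by linarith
  also have "\<dots> = 8 * B * (2 * \<rho> / (1 + \<rho>)) ^ N * ln (4 / (1 - \<rho>))"
    by (simp add: R_def mult.commute)
  finally show ?thesis .
qed

text \<open>A rotation moves z to the nonnegative real point |z|. It preserves the circles around 0
  and multiplies the n-th coefficient by u^n, so the Taylor sums agree term by term.\<close>

lemma taylor_remainder_bound:
  assumes f: "f holomorphic_on ball 0 1" and z: "cmod z < 1"
    and B: "\<And>w. cmod w = (1 + cmod z) / 2 \<Longrightarrow> cmod (f w) \<le> B"
  shows "cmod (f z - (\<Sum>n<N. taylor_coeff n f * z ^ n))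
           \<le> 8 * B * (2 * cmod z / (1 + cmod z)) ^ N * ln (4 / (1 - cmod z))"
proof -
  \<comment> \<open>Unlike z/|z|, this has modulus 1 also at z = 0.\<close>
  define u where "u = cis (Arg z)"
  have u: "cmod u = 1" "u * cmod z = z"
    using rcis_cmod_Arg[of z] by (auto simp: u_def rcis_def mult.commute)
  define g where "g = (\<lambda>w. f (u * w))"
  have "g holomorphic_on ball 0 1"
    unfolding g_def
    by (rule holomorphic_on_compose_gen[OF _ f, unfolded o_def]) (auto intro!: holomorphic_intros simp: norm_mult u)
  moreover have "taylor_coeff n g * cmod z ^ n = taylor_coeff n f * z ^ n" for n
  proof -
    have "taylor_coeff n g = u ^ n * taylor_coeff n f"
      using higher_deriv_compose_linear[OF f open_ball open_ball, of 0 0 1 u n] u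
      by (simp add: taylor_coeff_def g_def norm_mult)
    then have "taylor_coeff n g * cmod z ^ n = taylor_coeff n f * (u * cmod z) ^ n"
      by (simp add: power_mult_distrib)
    then show ?thesis by (simp only: u)
  qed
  moreover have "cmod (g w) \<le> B" if "cmod w = (1 + cmod z) / 2" for w
    unfolding g_def by (rule B) (use u that in \<open>simp add: norm_mult\<close>)
  moreover have "g (cmod z) = f z" by (simp only: g_def u)
  ultimately show ?thesis
    using taylor_remainder_bound_real[of g "cmod z" B N] z by simp
qed

section \<open>Decay of the weighted remainder, uniformly on the disc\<close>

lemma one_minus_power_le:
  fixes x :: real
  assumes "0 \<le> x" "x \<le> 1"
  shows "(1 - x) ^ N * (1 + N * x) \<le> 1"
proof -
  \<comment> \<open>Bernoulli's inequality turns the linear factor into (1 + x)^N, which pairs with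
    (1 - x)^N.\<close>
  have "(1 - x) ^ N * (1 + N * x) \<le> (1 - x) ^ N * (1 + x) ^ N"
    using Bernoulli_inequality[of x N] assms by (intro mult_left_mono) auto
  also have "\<dots> = (1 - x\<^sup>2) ^ N"
    by (simp add: power2_eq_square algebra_simps flip: power_mult_distrib)
  also have "\<dots> \<le> 1" using assms by (intro power_le_one) (auto intro: power_le_one)
  finally show ?thesis .
qed

text \<open>With \<open>y = 1 - |z|\<close> and \<open>R = (1 + |z|)/2\<close>, the base of the \<open>N\<close>-th power is \<open>|z|/R\<close>.\<close>
lemma powr_mult_power_le:
  fixes y a :: real
  assumes y: "0 < y" "y \<le> 1" and a: "0 \<le> a" "a \<le> 1" and N: "0 < N"
  shows "y powr a * (2 * (1 - y) / (2 - y)) ^ N \<le> (2 / N) powr a"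
proof -
  define c where "c = 1 + N * (y / 2)"
  have c: "1 \<le> c" using y by (simp add: c_def)
  \<comment> \<open>Equivalent to 4 (1 - y) \<le> (2 - y)^2.\<close>
  have "2 * (1 - y) / (2 - y) \<le> 1 - y / 2"
    using y by (simp add: field_simps)
  then have "(2 * (1 - y) / (2 - y)) ^ N \<le> (1 - y / 2) ^ N"
    using y by (intro power_mono) auto
  also have "\<dots> \<le> 1 / c"
  proof (subst pos_le_divide_eq)
    show "(1 - y / 2) ^ N * c \<le> 1"
      unfolding c_def using y by (intro one_minus_power_le) auto
  qed (use c in simp)
  \<comment> \<open>Weakening 1/c to 1/c^a, possible as c \<ge> 1 and a \<le> 1, lets it merge with
    y^a into (y/c)^a, where y/c \<le> 2/N holds uniformly in y.\<close>
  also have "\<dots> \<le> 1 / c powr a"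
    using c powr_mono[OF a(2) c] by (intro divide_left_mono) auto
  finally have "y powr a * (2 * (1 - y) / (2 - y)) ^ N \<le> y powr a * (1 / c powr a)"
    by (intro mult_left_mono) auto
  also have "\<dots> = (y / c) powr a" using y c by (simp add: powr_divide)
  also have "\<dots> \<le> (2 / N) powr a"
  proof (intro powr_mono2)
    have "y * N \<le> 2 * c" by (simp add: c_def)
    then show "y / c \<le> 2 / N" using c N by (simp add: field_simps)
  qed (use y c a in auto)
  finally show ?thesis .
qed

lemma growth_norm_taylor_remainder:
  assumes f: "f \<in> growth_space \<mu>" and \<mu>: "\<mu> < \<nu>"
  shows "(\<lambda>N. growth_norm_real \<nu> ((\<Sum>n<N. fun_scale (taylor_coeff n f) (monomial n)) - f)) \<longlonglongrightarrow> 0"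
proof -
  define M where "M = growth_norm_real \<mu> f"
  \<comment> \<open>The gap \<nu> - \<mu> pays twice: one power y^a absorbs the logarithm through ln
    x \<le> x^a / a, another buys decay in N. The cap at 1 is for
    \<open>powr_mult_power_le\<close>.\<close>
  define a where "a = min 1 ((\<nu> - \<mu>) / 2)"
  have a: "0 < a" "a \<le> 1" "a + a \<le> \<nu> - \<mu>" using \<mu> by (auto simp: a_def min_def)
  define K where "K = 8 * M * 2 powr \<mu> * (4 powr a / a)"
  have M: "0 \<le> M" unfolding M_def by (rule growth_norm_real_nonneg)
  have K: "0 \<le> K" using M a by (simp add: K_def)
  have bd: "growth_norm_real \<nu> ((\<Sum>n<N. fun_scale (taylor_coeff n f) (monomial n)) - f) \<le> K * (2 / N) powr a"
    if N: "0 < N" for N :: nat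
  proof (rule growth_norm_real_least)
    fix z :: complex assume z: "z \<in> ball 0 1"
    define y where "y = 1 - cmod z"
    have y: "0 < y" "y \<le> 1" "cmod z = 1 - y" using z by (auto simp: y_def)
    define q where "q = (2 * (1 - y) / (2 - y)) ^ N"
    have q: "0 \<le> q" using y by (simp add: q_def)
    have B: "cmod (f w) \<le> M * (2 powr \<mu> * y powr (- \<mu>))" if w: "cmod w = (1 + cmod z) / 2" for w
    proof -
      \<comment> \<open>On the midway circle the distance to the boundary is only halved, so the
        growth bound for f loses just the factor 2^\<mu>.\<close>
      have w': "1 - cmod w = y / 2" "w \<in> ball 0 1" using w z by (auto simp: y_def field_simps)
      have "cmod (f w) * (y / 2) powr \<mu> \<le> M"
        using growth_norm_real_upper[OF f w'(2)] unfolding w'(1) unfolding M_def .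
      then show ?thesis using y by (simp add: powr_divide powr_minus field_simps)
    qed
    have "cmod (f z - (\<Sum>n<N. taylor_coeff n f * z ^ n))
        \<le> 8 * (M * (2 powr \<mu> * y powr (- \<mu>))) * (2 * cmod z / (1 + cmod z)) ^ N * ln (4 / (1 - cmod z))"
      using z by (intro taylor_remainder_bound growth_space_holomorphic[OF f] B) auto
    also have "\<dots> = 8 * M * 2 powr \<mu> * y powr (- \<mu>) * q * ln (4 / y)"
      by (simp add: q_def y(3))
    also have "\<dots> \<le> 8 * M * 2 powr \<mu> * y powr (- \<mu>) * q * ((4 / y) powr a / a)"
      using M q y a by (intro mult_left_mono ln_powr_bound) auto
    also have "\<dots> = K * (y powr (- \<mu>) * y powr (- a) * q)"
    proof -
      have "(4 / y) powr a = 4 powr a * y powr (- a)"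
        using y by (simp add: powr_divide powr_minus_divide)
      then show ?thesis by (simp only: K_def divide_inverse mult_ac)
    qed
    finally have *: "cmod (f z - (\<Sum>n<N. taylor_coeff n f * z ^ n)) \<le> K * (y powr (- \<mu>) * y powr (- a) * q)" .
    have "cmod (((\<Sum>n<N. fun_scale (taylor_coeff n f) (monomial n)) - f) z) * (1 - cmod z) powr \<nu>
        = cmod (f z - (\<Sum>n<N. taylor_coeff n f * z ^ n)) * y powr \<nu>"
      using z by (simp add: sum_monomial norm_minus_commute y_def)
    also have "\<dots> \<le> K * (y powr (- \<mu>) * y powr (- a) * q) * y powr \<nu>"
      using * by (rule mult_right_mono) simp
    also have "\<dots> = K * (y powr (\<nu> - \<mu> - a) * q)"
    proof -
      have "y powr (\<nu> - \<mu> - a) = y powr (- \<mu>) * y powr (- a) * y powr \<nu>"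
        by (simp add: algebra_simps flip: powr_add)
      then show ?thesis by (simp only: mult_ac)
    qed
    \<comment> \<open>Here \<nu> - \<mu> - a \<ge> a, and y \<le> 1 reverses the order of the
      exponents.\<close>
    also have "\<dots> \<le> K * (y powr a * q)"
      using K q y a by (intro mult_left_mono mult_right_mono powr_mono') auto
    also have "\<dots> \<le> K * (2 / N) powr a"
      unfolding q_def using K y a N by (intro mult_left_mono powr_mult_power_le) auto
    finally show "cmod (((\<Sum>n<N. fun_scale (taylor_coeff n f) (monomial n)) - f) z) * (1 - cmod z) powr \<nu>
        \<le> K * (2 / N) powr a" .
  qed
  have "(\<lambda>N. K * (2 / real N) powr a) \<longlonglongrightarrow> 0"
    using a by real_asymp
  then show ?thesis
  proof (rule tendsto_sandwich[rotated 3])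
    show "\<forall>\<^sub>F N in sequentially. growth_norm_real \<nu> ((\<Sum>n<N. fun_scale (taylor_coeff n f) (monomial n)) - f)
        \<le> K * (2 / real N) powr a"
      using eventually_gt_at_top[of 0] by eventually_elim (rule bd)
  qed (auto simp: growth_norm_real_nonneg)
qed

section \<open>The monomial basis\<close>

text \<open>The index set \<open>I\<close> serves three purposes: all indices above \<gamma> for the
  intersection, the single index \<gamma> for the comparison topology on the union, and a single
  index \<nu> for one Banach space.\<close>

lemma seminormed_growth_space:
  assumes "module.subspace fun_scale E" "I \<noteq> {}" "\<And>\<mu>. \<mu> \<in> I \<Longrightarrow> E \<subseteq> growth_space \<mu>"
  shows "seminormed_space fun_scale E (growth_norm_real ` I)"
proof -
  interpret vector_space fun_scale by (rule vector_space_fun_scale)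
  show ?thesis
    by unfold_locales (use assms seminorm_on_growth_norm_real in auto)
qed

lemma Hausdorff_growth_seminorms:
  assumes "module.subspace fun_scale E" "I \<noteq> {}" "\<And>\<mu>. \<mu> \<in> I \<Longrightarrow> E \<subseteq> growth_space \<mu>"
  shows "Hausdorff_space (seminorm_topology E (growth_norm_real ` I))"
proof -
  interpret seminormed_space fun_scale E "growth_norm_real ` I"
    using assms by (rule seminormed_growth_space)
  obtain \<mu> where "\<mu> \<in> I" using assms(2) by blast
  then have "\<exists>p\<in>growth_norm_real ` I. 0 < p f" if "f \<in> E" "f \<noteq> 0" for f
    using growth_norm_real_pos[of f \<mu>] assms(3) that by blast
  then show ?thesis by (rule Hausdorff_seminorm_topology)
qed

lemma linear_form_taylor_coeff:
  "E \<subseteq> growth_space \<mu> \<Longrightarrow> linear_form_on fun_scale E (taylor_coeff n)"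
  unfolding linear_form_on_def using taylor_coeff_linear by blast

lemma continuous_map_taylor_coeff:
  assumes "module.subspace fun_scale E" "I \<noteq> {}" "\<And>\<mu>. \<mu> \<in> I \<Longrightarrow> E \<subseteq> growth_space \<mu>"
  shows "continuous_map (seminorm_topology E (growth_norm_real ` I)) euclidean (taylor_coeff n)"
proof -
  interpret seminormed_space fun_scale E "growth_norm_real ` I"
    using assms by (rule seminormed_growth_space)
  obtain \<mu> where \<mu>: "\<mu> \<in> I" using assms(2) by blast
  show ?thesis
  proof (rule continuous_map_linear_form)
    show "linear_form_on fun_scale E (taylor_coeff n)"
      using assms(3)[OF \<mu>] by (rule linear_form_taylor_coeff)
    show "growth_norm_real \<mu> \<in> growth_norm_real ` I" using \<mu> by (rule imageI)
    show "cmod (taylor_coeff n f) \<le> 2 ^ n * 2 powr \<mu> * growth_norm_real \<mu> f" if "f \<in> E" for f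
      using assms(3)[OF \<mu>] that by (intro norm_taylor_coeff_le) blast
  qed
qed

text \<open>The last hypothesis leaves room below every index in \<open>I\<close>, which
  \<open>growth_norm_taylor_remainder\<close> consumes.\<close>

lemma limitin_taylor_sums:
  assumes "module.subspace fun_scale E" "I \<noteq> {}" "\<And>\<mu>. \<mu> \<in> I \<Longrightarrow> E \<subseteq> growth_space \<mu>"
    and "\<And>n. monomial n \<in> E" "f \<in> E" and f: "\<And>\<mu>. \<mu> \<in> I \<Longrightarrow> \<exists>\<nu><\<mu>. f \<in> growth_space \<nu>"
  shows "limitin (seminorm_topology E (growth_norm_real ` I))
           (\<lambda>N. \<Sum>n<N. fun_scale (taylor_coeff n f) (monomial n)) f sequentially"
proof -
  interpret seminormed_space fun_scale E "growth_norm_real ` I"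
    using assms(1-3) by (rule seminormed_growth_space)
  show ?thesis
  proof (rule limitin_seminorm_topology)
    show "(\<Sum>n<N. fun_scale (taylor_coeff n f) (monomial n)) \<in> E" for N
      using assms(4) by (intro subspace_sum[OF subspace_E] mem_E)
    show "(\<lambda>N. p ((\<Sum>n<N. fun_scale (taylor_coeff n f) (monomial n)) - f)) \<longlonglongrightarrow> 0"
      if "p \<in> growth_norm_real ` I" for p
      using that f growth_norm_taylor_remainder by blast
  qed (rule assms(5))
qed

section \<open>The intersection of growth spaces\<close>

lemma schauder_basis_growth_space_plus:
  assumes "0 \<le> \<gamma>"
  shows "schauder_basis fun_scale (growth_space_plus \<gamma>) (growth_topology_plus \<gamma>) monomial"
proof -
  interpret vector_space fun_scale by (rule vector_space_fun_scale)
  let ?E = "growth_space_plus \<gamma>" and ?I = "{\<gamma><..}"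
  have sub: "subspace ?E"
    unfolding growth_space_plus_def by (intro subspace_Int subspace_growth_space)
  have ne: "?I \<noteq> {}" by (metis gt_ex empty_iff greaterThan_iff)
  have E: "?E \<subseteq> growth_space \<mu>" if "\<mu> \<in> ?I" for \<mu>
    using that unfolding growth_space_plus_def by (rule INT_lower)
  have mon: "monomial n \<in> ?E" for n
    unfolding growth_space_plus_def using assms by (intro INT_I monomial_in_growth_space) simp
  interpret P: seminormed_space fun_scale ?E "growth_norm_real ` ?I"
    using sub ne E by (rule seminormed_growth_space)
  show ?thesis
    unfolding growth_topology_plus_def
  proof (rule schauder_basis_biorthogonal[where u = taylor_coeff])
    show "locally_convex_space fun_scale ?E (seminorm_topology ?E (growth_norm_real ` ?I))"
      unfolding locally_convex_space_def
      using P.locally_convex_topology Hausdorff_growth_seminorms[OF sub ne E] by blast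
    show "linear_form_on fun_scale ?E (taylor_coeff n)" for n
      using E[of "\<gamma> + 1"] by (intro linear_form_taylor_coeff[of _ "\<gamma> + 1"]) simp
    show "continuous_map (seminorm_topology ?E (growth_norm_real ` ?I)) euclidean (taylor_coeff n)" for n
      using sub ne E by (rule continuous_map_taylor_coeff)
    fix f assume f: "f \<in> ?E"
    \<comment> \<open>The room below \<mu> exists because the intersection runs over an open
      half-line of indices.\<close>
    have "\<exists>\<nu><\<mu>. f \<in> growth_space \<nu>" if \<mu>: "\<mu> \<in> ?I" for \<mu>
    proof -
      obtain \<nu> where "\<gamma> < \<nu>" "\<nu> < \<mu>" using \<mu> dense by auto
      then show ?thesis using E[of \<nu>] f by auto
    qed
    then show "limitin (seminorm_topology ?E (growth_norm_real ` ?I))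
        (\<lambda>N. \<Sum>n<N. fun_scale (taylor_coeff n f) (monomial n)) f sequentially"
      using sub ne E mon f by (intro limitin_taylor_sums)
  qed (rule mon taylor_coeff_monomial)+
qed

section \<open>The inductive limit of growth spaces\<close>

lemma schauder_basis_growth_space_minus:
  assumes \<gamma>: "0 < \<gamma>"
  shows "schauder_basis fun_scale (growth_space_minus \<gamma>) (growth_topology_minus \<gamma>) monomial"
proof -
  interpret vector_space fun_scale by (rule vector_space_fun_scale)
  let ?E = "growth_space_minus \<gamma>" and ?T = "growth_topology_minus \<gamma>"
  let ?T\<^sub>\<gamma> = "seminorm_topology ?E (growth_norm_real ` {\<gamma>})"
  have E_iff: "f \<in> ?E \<longleftrightarrow> (\<exists>\<mu>\<in>{0<..<\<gamma>}. f \<in> growth_space \<mu>)" for f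
    by (simp add: growth_space_minus_def)
  have sub: "subspace ?E"
  proof (rule subspaceI)
    show "0 \<in> ?E" using \<gamma> growth_space_0 dense[OF \<gamma>] by (auto simp: E_iff)
    show "f + g \<in> ?E" if fg: "f \<in> ?E" "g \<in> ?E" for f g
    proof -
      obtain \<mu> \<nu> where "\<mu> \<in> {0<..<\<gamma>}" "f \<in> growth_space \<mu>" "\<nu> \<in> {0<..<\<gamma>}" "g \<in> growth_space \<nu>"
        using fg by (auto simp: E_iff)
      \<comment> \<open>The union is directed: both summands lie in the space of the larger index,
        which is still below \<gamma>.\<close>
      then have "f + g \<in> growth_space (max \<mu> \<nu>)" "max \<mu> \<nu> \<in> {0<..<\<gamma>}"
        by (auto intro!: growth_space_add(1) intro: growth_space_mono(1))
      then show ?thesis unfolding E_iff by (rule bexI)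
    qed
    show "fun_scale c f \<in> ?E" if "f \<in> ?E" for c f
      using that growth_space_scale(1) by (auto simp: E_iff)
  qed
  have E: "?E \<subseteq> growth_space \<mu>" if "\<mu> \<in> {\<gamma>}" for \<mu>
    using that growth_space_mono(1) by (force simp: E_iff)
  have mon: "monomial n \<in> ?E" for n
    using monomial_in_growth_space dense[OF \<gamma>] by (auto simp: E_iff)
  have ne: "{\<gamma>} \<noteq> {}" by simp
  interpret N: seminormed_space fun_scale ?E "growth_norm_real ` {\<gamma>}"
    using sub ne E by (rule seminormed_growth_space)
  have G: "seminormed_space fun_scale (growth_space \<mu>) (growth_norm_real ` {\<mu>})" for \<mu>
    by (rule seminormed_growth_space) (auto intro: subspace_growth_space)
  have top: "topspace (growth_topology \<mu>) = growth_space \<mu>" for \<mu>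
    using seminormed_space.topspace_seminorm_topology[OF G] by (simp add: growth_topology_def)
  \<comment> \<open>For \<mu> < \<gamma> the norm of index \<gamma> is dominated by that of index
    \<mu>. Hence the comparison topology is one of those whose supremum defines \<open>?T\<close>,
    and so it is coarser than \<open>?T\<close>.\<close>
  have incl: "continuous_map S ?T\<^sub>\<gamma> (\<lambda>f. f)" if S: "S \<in> growth_topology ` {0<..<\<gamma>}" for S
  proof -
    obtain \<mu> where \<mu>: "\<mu> \<in> {0<..<\<gamma>}" "S = growth_topology \<mu>" using S by blast
    interpret G: seminormed_space fun_scale "growth_space \<mu>" "growth_norm_real ` {\<mu>}" by (rule G)
    show ?thesis
      unfolding \<mu>(2)
    proof (rule N.continuous_map_into_seminorm_topology)
      show "(\<lambda>f. f) ` topspace (growth_topology \<mu>) \<subseteq> ?E"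
        using \<mu>(1) unfolding top by (auto simp: growth_space_minus_def)
    next
      fix f p and \<epsilon> :: real
      assume f: "f \<in> topspace (growth_topology \<mu>)" and p: "p \<in> growth_norm_real ` {\<gamma>}" and \<epsilon>: "0 < \<epsilon>"
      let ?V = "{g \<in> growth_space \<mu>. growth_norm_real \<mu> (g - f) < \<epsilon>}"
      have f': "f \<in> growth_space \<mu>" using f by (simp add: top)
      have "openin (growth_topology \<mu>) ?V"
        using G.openin_seminorm_ball[OF f'] by (simp add: growth_topology_def)
      moreover have "f \<in> ?V" using f' \<epsilon> G.seminorm_0[of "growth_norm_real \<mu>"] by simp
      moreover have "p (g - f) < \<epsilon>" if g: "g \<in> ?V" for g
      proof -
        have "g - f \<in> growth_space \<mu>" using g f' by (intro G.mem_E(3)) auto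
        then have "growth_norm_real \<gamma> (g - f) \<le> growth_norm_real \<mu> (g - f)"
          using \<mu>(1) by (intro growth_space_mono(2)) auto
        then show ?thesis using g p by auto
      qed
      ultimately show "\<exists>V. openin (growth_topology \<mu>) V \<and> f \<in> V \<and> (\<forall>g\<in>V. p (g - f) < \<epsilon>)"
        by (intro exI[of _ ?V] conjI ballI)
    qed
  qed
  have sp: "topspace S \<subseteq> ?E" if "S \<in> growth_topology ` {0<..<\<gamma>}" for S
    using that unfolding growth_space_minus_def
    by (elim imageE, hypsubst, unfold top) (rule UN_upper)
  have lct: "locally_convex_topology fun_scale ?E ?T"
    unfolding growth_topology_minus_def
    using vector_space_fun_scale sub sp by (rule inductive_topology_finest(1))
  have into_T: "continuous_map S ?T (\<lambda>f. f)" if "S \<in> growth_topology ` {0<..<\<gamma>}" for S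
    unfolding growth_topology_minus_def
    using vector_space_fun_scale sub sp that by (rule inductive_topology_finest(2))
  have topT: "topspace ?T = ?E" using lct by (simp add: locally_convex_topology_def)
  have finer: "openin ?T U" if "openin ?T\<^sub>\<gamma> U" for U
    unfolding growth_topology_minus_def
    using N.locally_convex_topology incl that by (rule openin_inductive_topology)
  \<comment> \<open>This injective continuous map pulls back both the Hausdorff property and the
    continuity of the coefficients.\<close>
  have id: "continuous_map ?T ?T\<^sub>\<gamma> id"
    using topology_finer_continuous_id[of ?T\<^sub>\<gamma> ?T] finer topT N.topspace_seminorm_topology by simp
  have "Hausdorff_space ?T"
    using Hausdorff_growth_seminorms[OF sub ne E] id inj_on_id
    by (rule Hausdorff_space_injective_preimage)
  show ?thesis
  proof (rule schauder_basis_biorthogonal[where u = taylor_coeff])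
    show "locally_convex_space fun_scale ?E ?T"
      unfolding locally_convex_space_def using lct \<open>Hausdorff_space ?T\<close> by blast
    show "linear_form_on fun_scale ?E (taylor_coeff n)" for n
      using E[of \<gamma>] by (intro linear_form_taylor_coeff[of _ \<gamma>]) simp
    show "continuous_map ?T euclidean (taylor_coeff n)" for n
      using continuous_map_compose[OF id continuous_map_taylor_coeff[OF sub ne E, of n]]
      unfolding comp_id .
    fix f assume "f \<in> ?E"
    then obtain \<mu> where \<mu>: "\<mu> \<in> {0<..<\<gamma>}" "f \<in> growth_space \<mu>" by (auto simp: E_iff)
    \<comment> \<open>The strict inequality \<mu> < \<nu> gives convergence of the Taylor sums in
      the Banach space of index \<nu>; \<nu> < \<gamma> makes its inclusion into the inductive limit
      continuous, which transports the limit.\<close>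
    then obtain \<nu> where \<nu>: "\<mu> < \<nu>" "\<nu> < \<gamma>" using dense[of \<mu> \<gamma>] by auto
    have "limitin (seminorm_topology (growth_space \<nu>) (growth_norm_real ` {\<nu>}))
        (\<lambda>N. \<Sum>n<N. fun_scale (taylor_coeff n f) (monomial n)) f sequentially"
    proof (rule limitin_taylor_sums)
      show "f \<in> growth_space \<nu>" using \<mu>(2) \<nu>(1) by (intro growth_space_mono(1)[of f \<mu> \<nu>]) simp_all
      show "monomial n \<in> growth_space \<nu>" for n
        using \<mu>(1) \<nu>(1) by (intro monomial_in_growth_space) simp
      show "\<exists>\<mu><\<kappa>. f \<in> growth_space \<mu>" if "\<kappa> \<in> {\<nu>}" for \<kappa> using \<mu>(2) \<nu>(1) that by blast
    qed (use subspace_growth_space in simp_all)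
    then have "limitin (growth_topology \<nu>)
        (\<lambda>N. \<Sum>n<N. fun_scale (taylor_coeff n f) (monomial n)) f sequentially"
      by (simp add: growth_topology_def)
    moreover have "continuous_map (growth_topology \<nu>) ?T (\<lambda>f. f)"
      using \<mu> \<nu> by (intro into_T) auto
    ultimately show "limitin ?T (\<lambda>N. \<Sum>n<N. fun_scale (taylor_coeff n f) (monomial n)) f sequentially"
      using continuous_map_limit[of _ ?T "\<lambda>f. f"] unfolding o_def by blast
  qed (rule mon taylor_coeff_monomial)+
qed

theorem theorem2p4:
  shows "(\<forall>\<gamma>::real. 0 \<le> \<gamma> \<longrightarrow>
            schauder_basis fun_scale (growth_space_plus \<gamma>) (growth_topology_plus \<gamma>) monomial) \<and>
         (\<forall>\<gamma>::real. 0 < \<gamma> \<longrightarrow>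
            schauder_basis fun_scale (growth_space_minus \<gamma>) (growth_topology_minus \<gamma>) monomial)"
  using schauder_basis_growth_space_plus schauder_basis_growth_space_minus by blast

end
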